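(* For every integer $n\ge 1$, the thickness of the complete 3-partite graph $K_{1,n,n}$ is $$\theta(K_{1,n,n})=\left\lceil\frac{n+2}{4}\right\rceil.$$
   Context: All graphs are finite and simple. The thickness $\theta(G)$ of a graph $G$ is the minimum number of planar subgraphs of $G$ whose union is $G$. A complete $k$-partite graph is a graph whose vertex set can be partitioned into $k$ parts such that every edge has its ends in different parts and every two vertices in different parts are adjacent; $K_{p_1,\dots,p_k}$ denotes the complete $k$-partite graph whose $i$th part has $p_i$ vertices ($1\le i\le k$). *)

theory Defs
  imports
    "Graph_Theory.Digraph_Component"
    "HOL-Library.Disjoint_Sets"
    "HOL-Analysis.Analysis"
begin

text \<open>
  A finite simple graph is a \<^locale>\<open>pair_graph\<close>: a finite loop-free symmetric digraph without
  parallel arcs. An undirected edge \<open>uv\<close> is thus the pair of arcs \<open>(u, v)\<close> and \<open>(v, u)\<close>.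
\<close>

text \<open>
  A drawing without crossings: vertices are distinct points of the plane, edges are simple
  (continuous) arcs joining the points of their ends, and the interior of each edge contains no
  vertex and no point of another edge. The two arcs \<open>(u, v)\<close> and \<open>(v, u)\<close> of an edge carry the
  same curve, traversed in opposite directions.
\<close>

definition plane_drawing ::
  "'a pair_pre_digraph \<Rightarrow> ('a \<Rightarrow> complex) \<Rightarrow> ('a \<times> 'a \<Rightarrow> real \<Rightarrow> complex) \<Rightarrow> bool" where
  "plane_drawing G p c \<longleftrightarrow>
     inj_on p (pverts G) \<and>
     (\<forall>(u, v) \<in> parcs G.
        arc (c (u, v)) \<and> pathstart (c (u, v)) = p u \<and> pathfinish (c (u, v)) = p v \<and>
        c (v, u) = reversepath (c (u, v)) \<and>
        (path_image (c (u, v)) - {p u, p v}) \<inter> p ` pverts G = {} \<and>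
        (\<forall>(x, y) \<in> parcs G. {x, y} \<noteq> {u, v} \<longrightarrow>
           (path_image (c (u, v)) - {p u, p v}) \<inter> path_image (c (x, y)) = {}))"

definition planar :: "'a pair_pre_digraph \<Rightarrow> bool" where
  "planar G \<longleftrightarrow> pair_graph G \<and> (\<exists>p c. plane_drawing G p c)"

definition thickness :: "'a pair_pre_digraph \<Rightarrow> nat" where
  "thickness G =
     (LEAST k. \<exists>Hs. finite Hs \<and> card Hs = k \<and>
        (\<forall>H\<in>Hs. subgraph (with_proj H) (with_proj G) \<and> planar H) \<and>
        pre_digraph.Union (with_proj G) (with_proj ` Hs) = with_proj G)"

text \<open>
  \<open>complete_multipartite ps G\<close> says that \<open>G\<close> is (a copy of) the complete multipartite graph
  whose \<open>i\<close>th part has \<open>ps ! i\<close> vertices.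
\<close>

definition complete_multipartite :: "nat list \<Rightarrow> 'a pair_pre_digraph \<Rightarrow> bool" where
  "complete_multipartite ps G \<longleftrightarrow> pair_graph G \<and>
     (\<exists>P :: nat \<Rightarrow> 'a set.
        disjoint_family_on P {..<length ps} \<and>
        pverts G = (\<Union>i<length ps. P i) \<and>
        (\<forall>i<length ps. card (P i) = ps ! i) \<and>
        parcs G = {(u, v). \<exists>i<length ps. \<exists>j<length ps. i \<noteq> j \<and> u \<in> P i \<and> v \<in> P j})"

lemma complete_multipartite_exists:
  "\<exists>G :: (nat \<times> nat) pair_pre_digraph. complete_multipartite ps G"
proof -
  define P where "P i = {i} \<times> {..<ps ! i}" for i
  define G where "G = \<lparr>pverts = (\<Union>i<length ps. P i),
    parcs = {(u, v). \<exists>i<length ps. \<exists>j<length ps. i \<noteq> j \<and> u \<in> P i \<and> v \<in> P j}\<rparr>"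
  have V: "finite (pverts G)"
    by (auto simp: G_def P_def)
  have E: "parcs G \<subseteq> pverts G \<times> pverts G"
    by (auto simp: G_def)
  have "finite (parcs G)"
    using finite_subset[OF E] V by blast
  moreover have "sym (parcs G)"
    by (auto simp: sym_def G_def)
  moreover have "fst e \<noteq> snd e" if "e \<in> parcs G" for e
    using that by (auto simp: G_def P_def)
  ultimately have "pair_graph G"
    using V E by unfold_locales (auto simp: symmetric_def)
  moreover have "disjoint_family_on P {..<length ps}"
    by (auto simp: disjoint_family_on_def P_def)
  moreover have "card (P i) = ps ! i" for i
    by (simp add: P_def card_cartesian_product)
  ultimately have "complete_multipartite ps G"
    unfolding complete_multipartite_def by (intro conjI exI[of _ P]) (auto simp: G_def)
  then show ?thesis ..
qed

end

theory Submission
  imports Defs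
begin

text \<open>
  Lower bound. A planar drawing restricted to the edges between the two parts of size \<open>n\<close> is a
  system of \<open>E\<close> arcs on at most \<open>2n\<close> points. Adding the arcs one at a time, each arc either merges
  two path components or, by the Jordan curve theorem, splits a face; hence there are at least
  \<open>E - V + 2\<close> faces. By Janiszewski's theorem an arc touches at most two faces, and a face touches
  at least four arcs, because three arcs of a bipartite system form a forest and do not separate
  the plane. So \<open>E \<le> 4n - 4\<close>, and \<open>n\<^sup>2 \<le> k (4n - 4)\<close> when \<open>k\<close> planar graphs suffice.

  Upper bound. It suffices to treat \<open>n = 4p + 2\<close>. Cut \<open>4p\<close> vertices of either part into \<open>p\<close> groups
  of four. Layer \<open>s < p\<close> draws the edges within group \<open>s\<close> and half of the edges between group \<open>s\<close>
  and everything else; the outside vertices occur as middles of paths of length two parallel to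
  one of four fixed edges. One last layer collects the remaining edges. Every layer is a
  subgraph of an Apollonian network, which is drawn with straight lines by putting each new
  vertex at the centroid of an empty triangle.
\<close>

section \<open>Systems of arcs in the plane\<close>

hide_const (open) Digraph_Component.connected

text \<open>The lower bound comes from \<open>K_{n,n}\<close> alone: as
  \<open>n * n = (n - 1) * (n + 1) + 1\<close>, the inequality of the overview gives
  \<open>n + 1 < 4 * k\<close>, that is \<open>n + 2 \<le> 4 * k\<close>. The difficulty is
  therefore to fit the \<open>2 * n\<close> edges at the apex into layers whose number is just
  enough for the bipartite graph. The ceiling is constant for
  \<open>4 * p - 1 \<le> n \<le> 4 * p + 2\<close>, which explains the choice of the largest of
  these \<open>n\<close>. For it, a plane bipartite layer has room for \<open>4 * n - 4\<close>
  edges between the two parts, and an inner layer uses \<open>4 * n - 6\<close> of this room;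
  \<open>14 * p + 4\<close> edges are left, few and regular enough to be drawn as two chains. In an
  inner layer the apex reaches only six of the eight vertices of the group. Two vertices of the next
  group make up for this, and the last layer serves the two vertices of the first group that are
  still missed.\<close>

text \<open>By invariance of dimension: the inverse of \<open>g\<close> would inject an open part of
  the plane continuously into the real line. The consequence used later is that a new arc never
  fills up a whole face.\<close>

lemma interior_arc_image_empty:
  fixes g :: "real \<Rightarrow> complex"
  assumes "arc g"
  shows "interior (path_image g) = {}"
proof (rule ccontr)
  assume ne: "interior (path_image g) \<noteq> {}"
  obtain h where "homeomorphism {0..1::real} (path_image g) g h"
    by (rule homeomorphism_arc[OF assms])
  then have h: "homeomorphism (path_image g) {0..1::real} h g"
    by (rule homeomorphism_symD)
  have "continuous_on (interior (path_image g)) h"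
    by (rule continuous_on_subset[OF homeomorphism_cont1[OF h] interior_subset])
  moreover have "inj_on h (interior (path_image g))"
    by (rule inj_on_inverseI[of _ g])
      (use homeomorphism_apply1[OF h] interior_subset in blast)
  ultimately show False
    using invariance_of_dimension[of "interior (path_image g)" h] ne by simp
qed

abbreviation arc_inner :: "(real \<Rightarrow> complex) \<Rightarrow> complex set" where
  "arc_inner g \<equiv> path_image g - {pathstart g, pathfinish g}"

lemma connected_arc_inner: "connected (arc_inner g)" if "arc g"
  using connected_simple_path_endless[OF arc_imp_simple_path[OF that]] .

lemma arc_inner_nonempty: "arc_inner g \<noteq> {}" if "arc g"
  using arc_imp_simple_path nonempty_simple_path_endless that by blast

text \<open>A drawing with the names of the edges forgotten. \<open>P\<close> stays the same when
  arcs are removed, so isolated points are allowed and inductions over \<open>A\<close> compare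
  drawings on one set of points. The members of \<open>A\<close> are curves and not point sets:
  their direction later encodes the bipartition.\<close>

locale arc_system =
  fixes P :: "complex set" and A :: "(real \<Rightarrow> complex) set"
  assumes finite_P: "finite P" and finite_A: "finite A"
    and arcs: "g \<in> A \<Longrightarrow> arc g"
    and ends: "g \<in> A \<Longrightarrow> pathstart g \<in> P" "g \<in> A \<Longrightarrow> pathfinish g \<in> P"
    and inner_P: "g \<in> A \<Longrightarrow> arc_inner g \<inter> P = {}"
    and inner_arc: "\<lbrakk>g \<in> A; h \<in> A; g \<noteq> h\<rbrakk> \<Longrightarrow> arc_inner g \<inter> path_image h = {}"

lemma arc_system_subset:
  assumes "arc_system P A" "B \<subseteq> A"
  shows "arc_system P B"
proof -
  interpret arc_system P A by fact
  have sub: "g \<in> A" if "g \<in> B" for g using that assms(2) by blast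
  show ?thesis
    by (rule arc_system.intro)
      (fact finite_P finite_subset[OF assms(2) finite_A] arcs[OF sub] ends[OF sub] inner_P[OF sub]
        inner_arc[OF sub sub])+
qed

definition drawn :: "complex set \<Rightarrow> (real \<Rightarrow> complex) set \<Rightarrow> complex set" where
  "drawn P A = P \<union> (\<Union>g\<in>A. path_image g)"

context arc_system
begin

lemma compact_drawn: "compact (drawn P A)"
proof -
  have "compact (\<Union>g\<in>A. path_image g)"
    using finite_A by (rule compact_UN) (rule compact_arc_image[OF arcs])
  then show ?thesis
    unfolding drawn_def using finite_imp_compact[OF finite_P] by (rule compact_Un[rotated])
qed

lemma closed_drawn: "closed (drawn P A)"
  by (rule compact_imp_closed[OF compact_drawn])

lemma ends_distinct: "g \<in> A \<Longrightarrow> pathstart g \<noteq> pathfinish g"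
  using arc_distinct_ends[OF arcs] by metis

lemma path_image_Int:
  assumes "g \<in> A" "h \<in> A" "g \<noteq> h"
  shows "path_image g \<inter> path_image h \<subseteq> {pathstart g, pathfinish g} \<inter> {pathstart h, pathfinish h}"
  using inner_arc[OF assms] inner_arc[OF assms(2,1)] assms(3) by auto

lemma drawn_remove: "g \<in> A \<Longrightarrow> drawn P A = drawn P (A - {g}) \<union> path_image g"
  unfolding drawn_def by auto

lemma inner_drawn_remove:
  assumes "g \<in> A"
  shows "arc_inner g \<inter> drawn P (A - {g}) = {}"
  using inner_P[OF assms] inner_arc[OF assms] unfolding drawn_def by blast

lemma arc_Int_drawn_remove:
  assumes "g \<in> A"
  shows "path_image g \<inter> drawn P (A - {g}) = {pathstart g, pathfinish g}"
  using inner_drawn_remove[OF assms] ends[OF assms] unfolding drawn_def by auto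

lemma arc_subset_drawn: "g \<in> A \<Longrightarrow> path_image g \<subseteq> drawn P A"
  unfolding drawn_def by auto

lemma remove: "arc_system P (A - {g})"
  by (rule arc_system_subset[OF arc_system_axioms]) auto

text \<open>A path joining the ends of \<open>g\<close> in the rest of the drawing contains an arc
  \<open>h\<close>, and \<open>g +++ h\<close> is a Jordan curve. The last conclusion is what
  Janiszewski's theorem asks for: the curve meets the rest of the drawing in a connected
  set.\<close>

lemma closed_cycle:
  assumes g: "g \<in> A"
    and pc: "path_component (drawn P (A - {g})) (pathfinish g) (pathstart g)"
  obtains h where "arc h" "path_image h \<subseteq> drawn P (A - {g})"
    "simple_path (g +++ h)" "pathfinish (g +++ h) = pathstart (g +++ h)"
    "path_image (g +++ h) = path_image g \<union> path_image h"
    "drawn P (A - {g}) \<inter> path_image (g +++ h) = path_image h"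
proof -
  obtain q where q: "path q" "path_image q \<subseteq> drawn P (A - {g})"
    "pathstart q = pathfinish g" "pathfinish q = pathstart g"
    using pc unfolding path_component_def by blast
  obtain h where h: "arc h" "path_image h \<subseteq> path_image q"
    "pathstart h = pathfinish g" "pathfinish h = pathstart g"
    using path_contains_arc[OF q(1,3,4)] ends_distinct[OF g] by metis
  have hY: "path_image h \<subseteq> drawn P (A - {g})"
    using h q by blast
  have "path_image g \<inter> path_image h \<subseteq> {pathstart g, pathstart h}"
    using hY arc_Int_drawn_remove[OF g] h by auto
  then have "simple_path (g +++ h)"
    using simple_path_join_loop[of g h] arcs[OF g] h by auto
  moreover have "path_image (g +++ h) = path_image g \<union> path_image h"
    using h by (simp add: path_image_join)
  moreover have "{pathstart g, pathfinish g} \<subseteq> path_image h"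
    using h by (metis empty_subsetI insert_subset pathfinish_in_path_image pathstart_in_path_image)
  moreover have "drawn P (A - {g}) \<inter> (path_image g \<union> path_image h) = path_image h"
    using calculation(3) hY arc_Int_drawn_remove[OF g] by blast
  ultimately show thesis
    using that[OF h(1) hY] h(3,4) by simp
qed

text \<open>Each remaining arc is path connected, hence lies inside or outside the path component of
  the start of \<open>g\<close>. Collecting the finitely many points and arcs on either side shows
  that both pieces are compact.\<close>

lemma split_off_start:
  assumes g: "g \<in> A"
    and npc: "\<not> path_component (drawn P (A - {g})) (pathstart g) (pathfinish g)"
  obtains Y1 Y2 where "compact Y1" "compact Y2" "drawn P (A - {g}) = Y1 \<union> Y2" "Y1 \<inter> Y2 = {}"
    "pathstart g \<in> Y1" "pathfinish g \<in> Y2"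
proof -
  let ?Y = "drawn P (A - {g})"
  define K where "K = path_component_set ?Y (pathstart g)"
  have sY: "pathstart g \<in> ?Y" "pathfinish g \<in> ?Y"
    using ends[OF g] unfolding drawn_def by auto
  have edge: "path_image h \<subseteq> K \<or> path_image h \<inter> K = {}" if "h \<in> A - {g}" for h
  proof (rule disjCI)
    assume "\<not> path_image h \<inter> K = {}"
    then obtain z where z: "z \<in> path_image h" "z \<in> K" by blast
    have "path_connected (path_image h)"
      using that arcs by (simp add: arc_imp_path path_connected_path_image)
    moreover have "path_image h \<subseteq> ?Y" using that unfolding drawn_def by auto
    ultimately have "path_image h \<subseteq> path_component_set ?Y z"
      using path_component_maximal z(1) by blast
    then show "path_image h \<subseteq> K"
      using z(2) path_component_eq unfolding K_def by blast
  qed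
  define Y1 where "Y1 = drawn (P \<inter> K) {h \<in> A - {g}. path_image h \<subseteq> K}"
  define Y2 where "Y2 = drawn (P - K) {h \<in> A - {g}. path_image h \<inter> K = {}}"
  have "compact (drawn Q B)" if "finite Q" "B \<subseteq> A" for Q B
  proof -
    have "compact (\<Union>g\<in>B. path_image g)"
      using finite_subset[OF that(2) finite_A] by (rule compact_UN) (use that(2) arcs compact_arc_image in blast)
    then show ?thesis
      unfolding drawn_def using finite_imp_compact[OF that(1)] by (rule compact_Un[rotated])
  qed
  then have "compact Y1" "compact Y2"
    unfolding Y1_def Y2_def using finite_P by auto
  moreover have "?Y = Y1 \<union> Y2"
    unfolding Y1_def Y2_def using edge unfolding drawn_def by blast
  moreover have "Y1 \<inter> Y2 = {}"
    unfolding Y1_def Y2_def drawn_def by blast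
  moreover have "Y1 \<subseteq> K" "Y2 \<inter> K = {}"
    unfolding Y1_def Y2_def drawn_def by auto
  moreover have "pathstart g \<in> K" "pathfinish g \<notin> K"
    using npc sY by (auto simp: K_def path_component_refl)
  ultimately show thesis using that[of Y1 Y2] sY by blast
qed

section \<open>Faces touched by an arc\<close>

lemma face_open: "F \<in> components (- drawn P A) \<Longrightarrow> open F"
  by (rule open_components[OF open_Compl[OF closed_drawn]])

text \<open>Both faces stay connected when a touched point of \<open>g\<close> is added, and the
  inner part of \<open>g\<close> links these points. This supplies one of the non-separation
  hypotheses of Janiszewski's theorem.\<close>

lemma touching_faces_connected:
  assumes g: "g \<in> A"
    and F: "F1 \<in> components (- drawn P A)" "F2 \<in> components (- drawn P A)"
    and t: "arc_inner g \<inter> closure F1 \<noteq> {}" "arc_inner g \<inter> closure F2 \<noteq> {}"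
    and a: "a1 \<in> F1" "a2 \<in> F2"
  shows "connected_component (- drawn P (A - {g})) a1 a2"
proof -
  obtain z1 z2 where z: "z1 \<in> arc_inner g" "z1 \<in> closure F1" "z2 \<in> arc_inner g" "z2 \<in> closure F2"
    using t by blast
  have "connected (insert z F)" if "F \<in> components (- drawn P A)" "z \<in> closure F" for F z
    by (rule connected_intermediate_closure[OF in_components_connected[OF that(1)]])
      (use that(2) closure_subset in auto)
  then have c: "connected (insert z1 F1)" "connected (insert z2 F2)"
    using F z by blast+
  have ci: "connected (arc_inner g)" using connected_arc_inner arcs g by blast
  have "connected (insert z1 F1 \<union> arc_inner g)"
    using c(1) ci by (rule connected_Un) (use z in blast)
  then have "connected (insert z1 F1 \<union> arc_inner g \<union> insert z2 F2)"
    using c(2) by (rule connected_Un) (use z in blast)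
  moreover have "F1 \<subseteq> - drawn P A" "F2 \<subseteq> - drawn P A"
    using F in_components_subset by blast+
  then have "insert z1 F1 \<union> arc_inner g \<union> insert z2 F2 \<subseteq> - drawn P (A - {g})"
    using inner_drawn_remove[OF g] drawn_remove[OF g] z by auto
  ultimately show ?thesis
    unfolding connected_component_def using a by blast
qed

lemma faces_eqI:
  assumes "F1 \<in> components (- drawn P A)" "F2 \<in> components (- drawn P A)"
    and "a1 \<in> F1" "a2 \<in> F2" "connected_component (- drawn P A) a1 a2"
  shows "F1 = F2"
proof -
  obtain T where T: "connected T" "T \<subseteq> - drawn P A" "a1 \<in> T" "a2 \<in> T"
    using assms(5) unfolding connected_component_def by blast
  then have "T \<subseteq> F1"
    using components_maximal[OF assms(1)] assms(3) by blast
  then show ?thesis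
    using components_eq[OF assms(1,2)] assms(4) T(4) by blast
qed

text \<open>Janiszewski's theorem is applied twice to glue three sets none of which separates the
  two faces: \<open>g\<close> to \<open>Y1\<close>, then \<open>Y2\<close> to the result. The
  intersections are single points, the two ends of \<open>g\<close>.\<close>

lemma bridge_touches_one_face:
  assumes g: "g \<in> A"
    and npc: "\<not> path_component (drawn P (A - {g})) (pathstart g) (pathfinish g)"
    and F: "F1 \<in> components (- drawn P A)" "F2 \<in> components (- drawn P A)"
    and t: "arc_inner g \<inter> closure F1 \<noteq> {}" "arc_inner g \<inter> closure F2 \<noteq> {}"
  shows "F1 = F2"
proof -
  obtain a1 a2 where a: "a1 \<in> F1" "a2 \<in> F2"
    using F in_components_nonempty by blast
  obtain Y1 Y2 where Y: "compact Y1" "compact Y2" "drawn P (A - {g}) = Y1 \<union> Y2" "Y1 \<inter> Y2 = {}"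
    "pathstart g \<in> Y1" "pathfinish g \<in> Y2"
    using split_off_start[OF g npc] by blast
  have cY: "connected_component (- (Y1 \<union> Y2)) a1 a2"
    using touching_faces_connected[OF g F t a] Y(3) by simp
  have i: "Y1 \<inter> path_image g = {pathstart g}" "(Y1 \<union> path_image g) \<inter> Y2 = {pathfinish g}"
    using arc_Int_drawn_remove[OF g] Y ends_distinct[OF g] by auto
  have aX: "a1 \<notin> drawn P A" "a2 \<notin> drawn P A"
    using a F in_components_subset by blast+
  have "connected (- path_image g)"
    using connected_arc_complement arcs[OF g] by force
  then have "connected_component (- path_image g) a1 a2"
    using aX arc_subset_drawn[OF g] connected_iff_connected_component by blast
  moreover have "connected_component (- Y1) a1 a2"
    using cY connected_component_of_subset by blast
  ultimately have "connected_component (- (Y1 \<union> path_image g)) a1 a2"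
    using Janiszewski[of Y1 "path_image g" a1 a2] Y(1) i(1) arcs[OF g]
    by (simp add: closed_arc_image)
  moreover have "connected_component (- Y2) a1 a2"
    using cY connected_component_of_subset by blast
  ultimately have "connected_component (- ((Y1 \<union> path_image g) \<union> Y2)) a1 a2"
    using Janiszewski[of "Y1 \<union> path_image g" Y2 a1 a2] Y(1,2) i(2) arcs[OF g]
    by (simp add: compact_Un compact_arc_image compact_imp_closed)
  moreover have "(Y1 \<union> path_image g) \<union> Y2 = drawn P A"
    using drawn_remove[OF g] Y(3) by auto
  ultimately show ?thesis using faces_eqI[OF F a] by simp
qed

text \<open>The curve \<open>c\<close> and the rest of the drawing meet in the arc \<open>h\<close>,
  so by Janiszewski's theorem two points separated by neither are not separated by their union.
  Hence each side of the curve contains at most one face touching \<open>g\<close>.\<close>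

lemma cycle_arc_same_side:
  assumes g: "g \<in> A" and h: "arc h"
    and c: "drawn P (A - {g}) \<inter> path_image c = path_image h" "path_image g \<subseteq> path_image c"
      "path_image c \<subseteq> drawn P A" "compact (path_image c)"
    and F: "F1 \<in> components (- drawn P A)" "F2 \<in> components (- drawn P A)"
    and t: "arc_inner g \<inter> closure F1 \<noteq> {}" "arc_inner g \<inter> closure F2 \<noteq> {}"
    and S: "connected S" "S \<subseteq> - path_image c" "F1 \<subseteq> S" "F2 \<subseteq> S"
  shows "F1 = F2"
proof -
  obtain a1 a2 where a: "a1 \<in> F1" "a2 \<in> F2"
    using F in_components_nonempty by blast
  have cY: "connected_component (- drawn P (A - {g})) a1 a2"
    using touching_faces_connected[OF g F t a] .
  have cc: "connected_component (- path_image c) a1 a2"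
    unfolding connected_component_def using S a by blast
  have "connected_component (- (drawn P (A - {g}) \<union> path_image c)) a1 a2"
    using Janiszewski[of "drawn P (A - {g})" "path_image c" a1 a2] cY cc c(1,4) h
      arc_system.compact_drawn[OF remove]
    by (simp add: connected_arc_image compact_imp_closed)
  moreover have "drawn P (A - {g}) \<union> path_image c = drawn P A"
    using drawn_remove[OF g] c by auto
  ultimately show ?thesis using faces_eqI[OF F a] by simp
qed

text \<open>A bridge touches only one face. Any other \<open>g\<close> lies on a Jordan curve inside
  the drawing, and of three touching faces two would be on the same side of it.\<close>

lemma touches_at_most_two_faces:
  assumes g: "g \<in> A" and \<F>: "\<F> \<subseteq> components (- drawn P A)"
  shows "card {F \<in> \<F>. arc_inner g \<inter> closure F \<noteq> {}} \<le> 2"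
proof (rule ccontr)
  assume "\<not> ?thesis"
  then have "3 \<le> card {F \<in> \<F>. arc_inner g \<inter> closure F \<noteq> {}}" by simp
  then obtain T where T: "T \<subseteq> {F \<in> \<F>. arc_inner g \<inter> closure F \<noteq> {}}" "card T = 3"
    by (rule obtain_subset_with_card_n)
  then obtain F1 F2 F3 where "T = {F1, F2, F3}" and ne: "F1 \<noteq> F2" "F1 \<noteq> F3" "F2 \<noteq> F3"
    unfolding card_3_iff by blast
  with T(1) \<F> have F: "F1 \<in> components (- drawn P A)" "F2 \<in> components (- drawn P A)"
      "F3 \<in> components (- drawn P A)"
    and t: "arc_inner g \<inter> closure F1 \<noteq> {}" "arc_inner g \<inter> closure F2 \<noteq> {}"
      "arc_inner g \<inter> closure F3 \<noteq> {}"
    by auto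
  have "path_component (drawn P (A - {g})) (pathstart g) (pathfinish g)"
    by (rule ccontr) (use bridge_touches_one_face[OF g _ F(1,2) t(1,2)] ne(1) in simp)
  then have pc: "path_component (drawn P (A - {g})) (pathfinish g) (pathstart g)"
    by (rule path_component_sym)
  obtain h where h: "arc h" "path_image h \<subseteq> drawn P (A - {g})"
    and c: "simple_path (g +++ h)" "pathfinish (g +++ h) = pathstart (g +++ h)"
      "path_image (g +++ h) = path_image g \<union> path_image h"
      "drawn P (A - {g}) \<inter> path_image (g +++ h) = path_image h"
    by (rule closed_cycle[OF g pc])
  let ?C = "path_image (g +++ h)"
  have CX: "?C \<subseteq> drawn P A"
    using h c drawn_remove[OF g] by auto
  have Cc: "compact ?C"
    using c(1) by (simp add: compact_simple_path_image)
  obtain I O' where IO: "connected I" "connected O'" "I \<inter> O' = {}" "I \<union> O' = - ?C" "open I" "open O'"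
    by (rule Jordan_curve[OF c(1,2)])
  have side: "F \<subseteq> I \<or> F \<subseteq> O'" if "F \<in> components (- drawn P A)" for F
  proof -
    have "F \<subseteq> I \<union> O'" using in_components_subset[OF that] CX IO(4) by blast
    then show ?thesis
      using connectedD[OF in_components_connected[OF that] IO(5,6)] IO(3) by blast
  qed
  note same = cycle_arc_same_side[OF g h(1) c(4) _ CX Cc]
  have sub: "path_image g \<subseteq> ?C" "I \<subseteq> - ?C" "O' \<subseteq> - ?C" using c IO by auto
  note s1 = same[OF sub(1) _ _ _ _ IO(1) sub(2)]
  note s2 = same[OF sub(1) _ _ _ _ IO(2) sub(3)]
  have "\<not> (F1 \<subseteq> I \<and> F2 \<subseteq> I)" "\<not> (F1 \<subseteq> I \<and> F3 \<subseteq> I)" "\<not> (F2 \<subseteq> I \<and> F3 \<subseteq> I)"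
    using s1[OF F(1,2) t(1,2)] s1[OF F(1,3) t(1,3)] s1[OF F(2,3) t(2,3)] ne by metis+
  moreover have "\<not> (F1 \<subseteq> O' \<and> F2 \<subseteq> O')" "\<not> (F1 \<subseteq> O' \<and> F3 \<subseteq> O')" "\<not> (F2 \<subseteq> O' \<and> F3 \<subseteq> O')"
    using s2[OF F(1,2) t(1,2)] s2[OF F(1,3) t(1,3)] s2[OF F(2,3) t(2,3)] ne by metis+
  ultimately show False
    using side[OF F(1)] side[OF F(2)] side[OF F(3)] by metis
qed

section \<open>Faces refined or split by a new arc\<close>

lemma face_refines:
  assumes g: "g \<in> A" and C: "C \<in> components (- drawn P (A - {g}))"
  obtains F where "F \<in> components (- drawn P A)" "F \<subseteq> C"
proof -
  have "open C" using arc_system.face_open[OF remove C] .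
  moreover have "C \<noteq> {}" using C in_components_nonempty by blast
  ultimately have "\<not> C \<subseteq> path_image g"
    using interior_arc_image_empty[OF arcs[OF g]] interior_maximal by blast
  then obtain z where z: "z \<in> C" "z \<notin> path_image g" by blast
  then have zX: "z \<in> - drawn P A"
    using in_components_subset[OF C] drawn_remove[OF g] by auto
  let ?F = "connected_component_set (- drawn P A) z"
  have F: "?F \<in> components (- drawn P A)" using zX by (rule componentsI)
  have "?F \<subseteq> C"
  proof (rule components_maximal[OF C in_components_connected[OF F]])
    show "?F \<subseteq> - drawn P (A - {g})"
      using in_components_subset[OF F] drawn_remove[OF g] by blast
    have "z \<in> ?F" using zX by simp
    then show "C \<inter> ?F \<noteq> {}" using z(1) by blast
  qed
  then show thesis by (rule that[OF F])
qed

text \<open>A point \<open>z\<close> inside \<open>g\<close> is on the frontier of both sides of a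
  Jordan curve through \<open>g\<close>. The open face around \<open>z\<close> in the system without
  \<open>g\<close> thus contains points of both sides, and these lie in different faces once
  \<open>g\<close> is present.\<close>

lemma face_splits:
  assumes g: "g \<in> A"
    and pc: "path_component (drawn P (A - {g})) (pathfinish g) (pathstart g)"
  obtains D F1 F2 where "D \<in> components (- drawn P (A - {g}))"
    "F1 \<in> components (- drawn P A)" "F2 \<in> components (- drawn P A)" "F1 \<noteq> F2" "F1 \<subseteq> D" "F2 \<subseteq> D"
proof -
  obtain z where z: "z \<in> arc_inner g"
    using arc_inner_nonempty[OF arcs[OF g]] by auto
  let ?Y = "drawn P (A - {g})"
  let ?D = "connected_component_set (- ?Y) z"
  have zY: "z \<in> - ?Y" using z inner_drawn_remove[OF g] by auto
  have D: "?D \<in> components (- ?Y)" using zY by (rule componentsI)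
  obtain h where h: "arc h" "path_image h \<subseteq> ?Y"
    and c: "simple_path (g +++ h)" "pathfinish (g +++ h) = pathstart (g +++ h)"
      "path_image (g +++ h) = path_image g \<union> path_image h"
      "?Y \<inter> path_image (g +++ h) = path_image h"
    by (rule closed_cycle[OF g pc])
  let ?C = "path_image (g +++ h)"
  obtain I O' where IO: "connected I" "connected O'" "I \<inter> O' = {}" "I \<union> O' = - ?C"
    "open I" "open O'" "frontier I = ?C" "frontier O' = ?C"
    by (rule Jordan_curve[OF c(1,2)])
  have zC: "z \<in> closure I" "z \<in> closure O'"
    using z c(3) IO(7,8) unfolding frontier_def by auto
  have "open ?D" using arc_system.face_open[OF remove D] .
  moreover have "z \<in> ?D" using zY by simp
  ultimately have "?D \<inter> I \<noteq> {}" "?D \<inter> O' \<noteq> {}"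
    using zC open_Int_closure_eq_empty[of ?D] by blast+
  then obtain a b where a: "a \<in> I" "a \<in> ?D" and b: "b \<in> O'" "b \<in> ?D"
    by blast
  have CX: "?C \<subseteq> drawn P A"
    using h c drawn_remove[OF g] by auto
  have ab: "a \<in> - drawn P A" "b \<in> - drawn P A"
    using a b IO(4) c(3) in_components_subset[OF D] drawn_remove[OF g] by auto
  let ?F = "connected_component_set (- drawn P A)"
  have F: "?F a \<in> components (- drawn P A)" "?F b \<in> components (- drawn P A)"
    by (rule componentsI[OF ab(1)], rule componentsI[OF ab(2)])
  have "?F a \<noteq> ?F b"
  proof (rule notI)
    assume "?F a = ?F b"
    moreover have "a \<in> ?F a" "b \<in> ?F b" using ab by simp_all
    ultimately have "?F a \<inter> O' \<noteq> {}" "?F a \<inter> I \<noteq> {}" using a(1) b(1) by blast+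
    moreover have "?F a \<subseteq> I \<union> O'"
      using in_components_subset[OF F(1)] CX IO(4) by blast
    ultimately show False
      using connectedD[OF in_components_connected[OF F(1)] IO(5,6)] IO(3) by blast
  qed
  moreover have sub: "?F w \<subseteq> ?D" if "w \<in> ?D" "w \<in> - drawn P A" for w
  proof (rule components_maximal[OF D connected_connected_component])
    show "?F w \<subseteq> - ?Y"
      using connected_component_subset[of "- drawn P A" w] drawn_remove[OF g] by blast
    have "w \<in> ?F w" using that(2) by simp
    then show "?D \<inter> ?F w \<noteq> {}" using that(1) by blast
  qed
  ultimately show thesis
    by (intro that[OF D F _ sub[OF a(2) ab(1)] sub[OF b(2) ab(2)]])
qed

end

section \<open>Euler's inequality for bipartite arc systems\<close>

text \<open>The arcs of an arc system have their ends in \<open>P\<close>, so every path component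
  of the drawing is counted; indexing by \<open>P\<close> makes the count visibly finite.\<close>

definition n_classes :: "complex set \<Rightarrow> (real \<Rightarrow> complex) set \<Rightarrow> nat" where
  "n_classes P A = card (path_component_set (drawn P A) ` P)"

context arc_system
begin

text \<open>Enlarging classes gives a surjection \<open>\<phi>\<close> from the classes without
  \<open>g\<close> onto those with \<open>g\<close>. If the ends of \<open>g\<close> lie in
  different classes, \<open>\<phi>\<close> identifies these two and the count drops.\<close>

lemma n_classes_remove:
  assumes g: "g \<in> A"
  shows "n_classes P A \<le> n_classes P (A - {g})"
    and "\<not> path_component (drawn P (A - {g})) (pathfinish g) (pathstart g) \<Longrightarrow>
      n_classes P A < n_classes P (A - {g})"
proof -
  let ?X = "drawn P A" and ?Y = "drawn P (A - {g})"
  let ?s = "pathstart g" and ?t = "pathfinish g"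
  define \<phi> where "\<phi> K = (\<Union>z\<in>K. path_component_set ?X z)" for K
  have YX: "?Y \<subseteq> ?X" using drawn_remove[OF g] by simp
  have PY: "P \<subseteq> ?Y" unfolding drawn_def by simp
  have \<phi>: "\<phi> (path_component_set ?Y v) = path_component_set ?X v" if "v \<in> P" for v
  proof
    show "\<phi> (path_component_set ?Y v) \<subseteq> path_component_set ?X v"
      unfolding \<phi>_def
      by (auto intro: path_component_trans path_component_of_subset[OF YX])
    have "v \<in> path_component_set ?Y v"
      using that PY by (auto simp: path_component_refl)
    then show "path_component_set ?X v \<subseteq> \<phi> (path_component_set ?Y v)"
      unfolding \<phi>_def by blast
  qed
  have fin: "finite (path_component_set ?Y ` P)" using finite_P by simp
  have im: "path_component_set ?X ` P = \<phi> ` path_component_set ?Y ` P"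
    using \<phi> by (force simp: image_image)
  show "n_classes P A \<le> n_classes P (A - {g})"
    unfolding n_classes_def im using fin by (rule card_image_le)
  assume npc: "\<not> path_component ?Y ?t ?s"
  have st: "?s \<in> P" "?t \<in> P" using ends[OF g] .
  let ?R = "path_component_set ?Y ` P"
  have "path_component ?X ?s ?t"
    unfolding path_component_def
    using arcs[OF g] arc_subset_drawn[OF g] by (blast intro: arc_imp_path)
  then have eq: "\<phi> (path_component_set ?Y ?s) = \<phi> (path_component_set ?Y ?t)"
    unfolding \<phi>[OF st(1)] \<phi>[OF st(2)] using path_component_eq[of ?t ?X ?s] by simp
  have "?s \<in> path_component_set ?Y ?s" "?s \<notin> path_component_set ?Y ?t"
    using st(1) PY npc by (auto simp: path_component_refl)
  then have ne: "path_component_set ?Y ?s \<noteq> path_component_set ?Y ?t" by blast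
  have "\<phi> ` ?R \<subseteq> \<phi> ` (?R - {path_component_set ?Y ?s})"
  proof
    fix K assume "K \<in> \<phi> ` ?R"
    then obtain C where C: "C \<in> ?R" "K = \<phi> C" by blast
    have T: "path_component_set ?Y ?t \<in> ?R - {path_component_set ?Y ?s}"
      using st(2) ne by blast
    show "K \<in> \<phi> ` (?R - {path_component_set ?Y ?s})"
    proof (cases "C = path_component_set ?Y ?s")
      case True
      then have "K = \<phi> (path_component_set ?Y ?t)" using C(2) eq by simp
      then show ?thesis using imageI[OF T, of \<phi>] by simp
    next
      case False
      then have "C \<in> ?R - {path_component_set ?Y ?s}" using C(1) by blast
      then show ?thesis unfolding C(2) by (rule imageI)
    qed
  qed
  then have "card (\<phi> ` ?R) \<le> card (\<phi> ` (?R - {path_component_set ?Y ?s}))"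
    by (rule card_mono[rotated]) (use fin in simp)
  also have "\<dots> \<le> card (?R - {path_component_set ?Y ?s})"
    by (rule card_image_le) (use fin in simp)
  also have "\<dots> < card ?R"
    by (rule card_Diff1_less[OF fin]) (use st(1) in simp)
  finally show "n_classes P A < n_classes P (A - {g})"
    unfolding n_classes_def im .
qed

text \<open>Distinct faces are disjoint, so it is injective to choose a face of the larger system
  inside each face of the smaller one. If \<open>g\<close> closes a cycle, one face contributes
  two.\<close>

lemma faces_transfer:
  assumes g: "g \<in> A" and fin: "finite \<F>" and \<F>: "\<F> \<subseteq> components (- drawn P (A - {g}))"
  shows "\<exists>\<G>. finite \<G> \<and> \<G> \<subseteq> components (- drawn P A) \<and> card \<G> = card \<F>"
    and "path_component (drawn P (A - {g})) (pathfinish g) (pathstart g) \<Longrightarrow>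
      \<exists>\<G>. finite \<G> \<and> \<G> \<subseteq> components (- drawn P A) \<and> card \<F> < card \<G>"
proof -
  let ?X = "drawn P A" and ?Y = "drawn P (A - {g})"
  have "\<exists>F. F \<in> components (- ?X) \<and> F \<subseteq> C" if "C \<in> \<F>" for C
  proof -
    have "C \<in> components (- ?Y)" using that \<F> by blast
    then obtain F where "F \<in> components (- ?X)" "F \<subseteq> C" by (rule face_refines[OF g])
    then show ?thesis by blast
  qed
  then obtain r where r: "r C \<in> components (- ?X)" "r C \<subseteq> C" if "C \<in> \<F>" for C
    by metis
  have disj: "C = C'" if "C \<in> components (- ?Y)" "C' \<in> components (- ?Y)"
    "F \<subseteq> C" "F \<subseteq> C'" "F \<in> components (- ?X)" for C C' F
    using components_eq[OF that(1,2)] that(3-5) in_components_nonempty by blast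
  have inj: "inj_on r \<F>"
  proof (rule inj_onI)
    fix C C' assume "C \<in> \<F>" "C' \<in> \<F>" "r C = r C'"
    then show "C = C'" using disj[of C C' "r C"] r[of C] r[of C'] \<F> by auto
  qed
  have "finite (r ` \<F>)" "r ` \<F> \<subseteq> components (- ?X)" "card (r ` \<F>) = card \<F>"
    using fin r(1) card_image[OF inj] by auto
  then show "\<exists>\<G>. finite \<G> \<and> \<G> \<subseteq> components (- ?X) \<and> card \<G> = card \<F>" by blast
  assume pc: "path_component ?Y (pathfinish g) (pathstart g)"
  obtain D F1 F2 where D: "D \<in> components (- ?Y)"
    and F: "F1 \<in> components (- ?X)" "F2 \<in> components (- ?X)" "F1 \<noteq> F2" "F1 \<subseteq> D" "F2 \<subseteq> D"
    by (rule face_splits[OF g pc])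
  \<comment> \<open>\<open>D\<close> may or may not be in \<open>\<F>\<close>: leaving it out loses
    at most one face, and its two subfaces \<open>F1\<close> and \<open>F2\<close> are not among the
    chosen ones.\<close>
  let ?G = "r ` (\<F> - {D}) \<union> {F1, F2}"
  have ni: "F \<notin> r ` (\<F> - {D})" if "F \<in> components (- ?X)" "F \<subseteq> D" for F
  proof
    assume "F \<in> r ` (\<F> - {D})"
    then obtain C where C: "C \<in> \<F>" "C \<noteq> D" "F = r C" by blast
    then show False using disj[OF _ D, of C F] r(2)[OF C(1)] \<F> that by auto
  qed
  have "card ?G = card (r ` (\<F> - {D})) + 2"
    using ni[OF F(1,4)] ni[OF F(2,5)] F(3) fin by simp
  also have "card (r ` (\<F> - {D})) = card (\<F> - {D})"
    by (rule card_image[OF inj_on_subset[OF inj]]) blast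
  finally have "card \<F> < card ?G"
    using diff_card_le_card_Diff[of "{D}" \<F>] by simp
  moreover have "finite ?G" "?G \<subseteq> components (- ?X)"
    using fin r(1) F by auto
  ultimately show "\<exists>\<G>. finite \<G> \<and> \<G> \<subseteq> components (- ?X) \<and> card \<F> < card \<G>" by blast
qed

end

text \<open>Euler's formula \<open>E + 1 + c = F + V\<close> as an inequality, with \<open>c\<close>
  the number of classes: a new arc lowers \<open>c\<close> or raises the number of faces. A finite
  set of faces is exhibited because \<open>card\<close> would be 0 on an infinite one.\<close>

lemma euler_faces_classes:
  assumes "arc_system P A"
  shows "\<exists>\<F>. finite \<F> \<and> \<F> \<subseteq> components (- drawn P A) \<and>
    card A + 1 + n_classes P A \<le> card \<F> + card P"
  using arc_system.finite_A[OF assms] assms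
proof (induction A rule: finite_induct)
  case empty
  then have fin: "finite P" by (simp add: arc_system.finite_P)
  then obtain z where "z \<notin> P" using ex_new_if_finite infinite_UNIV_char_0 by blast
  then have "z \<in> - drawn P {}" by (simp add: drawn_def)
  then have "{connected_component_set (- drawn P {}) z} \<subseteq> components (- drawn P {})"
    using componentsI[of z "- drawn P {}"] by blast
  moreover have "n_classes P {} \<le> card P"
    unfolding n_classes_def by (rule card_image_le[OF fin])
  ultimately show ?case
    by (intro exI[of _ "{connected_component_set (- drawn P {}) z}"]) auto
next
  case (insert g A)
  interpret arc_system P "insert g A" by fact
  have rem: "insert g A - {g} = A" using insert.hyps by simp
  have g: "g \<in> insert g A" by simp
  have "arc_system P A" using remove[of g] rem by simp
  then obtain \<F> where \<F>: "finite \<F>" "\<F> \<subseteq> components (- drawn P A)"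
    "card A + 1 + n_classes P A \<le> card \<F> + card P"
    using insert.IH by blast
  have cA: "card (insert g A) = card A + 1" using insert.hyps by simp
  note ncl = n_classes_remove[OF g, unfolded rem]
  note tr = faces_transfer[OF g \<F>(1), unfolded rem, OF \<F>(2)]
  show ?case
  proof (cases "path_component (drawn P A) (pathfinish g) (pathstart g)")
    case True
    then obtain \<G> where "finite \<G>" "\<G> \<subseteq> components (- drawn P (insert g A))" "card \<F> < card \<G>"
      using tr(2) by blast
    moreover have "card (insert g A) + 1 + n_classes P (insert g A) \<le> card \<G> + card P"
      using calculation(3) \<F>(3) ncl(1) cA by linarith
    ultimately show ?thesis by blast
  next
    case False
    obtain \<G> where "finite \<G>" "\<G> \<subseteq> components (- drawn P (insert g A))" "card \<G> = card \<F>"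
      using tr(1) by blast
    moreover have "card (insert g A) + 1 + n_classes P (insert g A) \<le> card \<G> + card P"
      using calculation(3) \<F>(3) ncl(2)[OF False] cA by linarith
    ultimately show ?thesis by blast
  qed
qed

section \<open>Faces of bipartite systems\<close>

text \<open>If every edge shared both its ends, there would be a path \<open>h2\<close>,
  \<open>g\<close>, \<open>h1\<close>, \<open>h3\<close> of four edges, distinct because an edge is
  determined by its ends.\<close>

lemma bipartite_few_edges_leaf:
  assumes "inj_on (\<lambda>g. (s g, t g)) B" "B \<noteq> {}" "finite B" "card B \<le> 3"
  shows "\<exists>g\<in>B. (\<forall>h\<in>B - {g}. s h \<noteq> s g) \<or> (\<forall>h\<in>B - {g}. t h \<noteq> t g)"
proof (rule ccontr)
  assume "\<not> ?thesis"
  then have *: "\<exists>h\<in>B - {g}. s h = s g" "\<exists>h\<in>B - {g}. t h = t g" if "g \<in> B" for g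
    using that by blast+
  obtain g where g: "g \<in> B" using assms(2) by blast
  obtain h1 where h1: "h1 \<in> B" "h1 \<noteq> g" "s h1 = s g" using *(1)[OF g] by blast
  obtain h2 where h2: "h2 \<in> B" "h2 \<noteq> g" "t h2 = t g" using *(2)[OF g] by blast
  obtain h3 where h3: "h3 \<in> B" "h3 \<noteq> h1" "t h3 = t h1" using *(2)[OF h1(1)] by blast
  have "t h1 \<noteq> t g" using inj_onD[OF assms(1) _ h1(1) g] h1 by auto
  then have "g \<noteq> h1" "g \<noteq> h2" "g \<noteq> h3" "h1 \<noteq> h2" "h1 \<noteq> h3" "h2 \<noteq> h3"
    using h1 h2 h3 by metis+
  then have "card {g, h1, h2, h3} = 4" by simp
  moreover have "card {g, h1, h2, h3} \<le> card B"
    by (rule card_mono[OF assms(3)]) (use g h1 h2 h3 in simp)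
  ultimately show False using assms(4) by simp
qed

text \<open>Induction by removing a leaf. Starts are never finishes, so two arcs meet only in a
  common start or a common finish; the arc of a leaf has at most one point in common with the rest,
  and Janiszewski's theorem keeps the complement connected.\<close>

lemma connected_complement_few_bipartite_arcs:
  assumes "arc_system P B" "inj_on (\<lambda>g. (pathstart g, pathfinish g)) B"
    "pathstart ` B \<inter> pathfinish ` B = {}" "card B \<le> 3"
  shows "connected (- (\<Union>g\<in>B. path_image g))"
  using assms
proof (induction "card B" arbitrary: B rule: less_induct)
  case less
  interpret arc_system P B by fact
  show ?case
  proof (cases "B = {}")
    case True
    then show ?thesis by (simp add: connected_UNIV)
  next
    case False
    obtain g where g: "g \<in> B" and leaf: "(\<forall>h\<in>B - {g}. pathstart h \<noteq> pathstart g) \<or>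
        (\<forall>h\<in>B - {g}. pathfinish h \<noteq> pathfinish g)"
      using bipartite_few_edges_leaf[OF less.prems(2) False finite_A less.prems(4)] by blast
    let ?T = "\<Union>h\<in>B - {g}. path_image h"
    have lt: "card (B - {g}) < card B" by (rule card_Diff1_less[OF finite_A g])
    have con: "connected (- ?T)"
    proof (rule less.hyps[OF lt remove])
      show "inj_on (\<lambda>g. (pathstart g, pathfinish g)) (B - {g})"
        by (rule inj_on_subset[OF less.prems(2)]) blast
      show "pathstart ` (B - {g}) \<inter> pathfinish ` (B - {g}) = {}"
        using less.prems(3) by blast
      show "card (B - {g}) \<le> 3" using lt less.prems(4) by simp
    qed
    have opp: "pathstart g \<noteq> pathfinish h" "pathfinish g \<noteq> pathstart h" if "h \<in> B" for h
      using less.prems(3) g that by blast+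
    have meet: "x = pathstart g \<and> x = pathstart h \<or> x = pathfinish g \<and> x = pathfinish h"
      if "x \<in> path_image g" "x \<in> path_image h" "h \<in> B - {g}" for x h
      using path_image_Int[OF g, of h] that opp[of h] by auto
    obtain e where "path_image g \<inter> ?T \<subseteq> {e}"
    proof (cases "\<forall>h\<in>B - {g}. pathstart h \<noteq> pathstart g")
      case True
      have "path_image g \<inter> ?T \<subseteq> {pathfinish g}"
      proof
        fix x assume "x \<in> path_image g \<inter> ?T"
        then obtain h where "x \<in> path_image g" "x \<in> path_image h" "h \<in> B - {g}" by blast
        then show "x \<in> {pathfinish g}" using meet[of x h] True by auto
      qed
      then show ?thesis by (rule that)
    next
      case False
      have "path_image g \<inter> ?T \<subseteq> {pathstart g}"
      proof
        fix x assume "x \<in> path_image g \<inter> ?T"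
        then obtain h where "x \<in> path_image g" "x \<in> path_image h" "h \<in> B - {g}" by blast
        then show "x \<in> {pathstart g}" using meet[of x h] leaf False by auto
      qed
      then show ?thesis by (rule that)
    qed
    then have "path_image g \<inter> ?T = {} \<or> path_image g \<inter> ?T = {e}"
      by (rule subset_singletonD)
    then have int: "connected (path_image g \<inter> ?T)"
      by (metis connected_empty connected_sing)
    have "compact ?T"
      by (rule compact_UN) (use finite_A in simp, rule compact_arc_image[OF arcs], simp)
    moreover have "connected (- path_image g)"
      using connected_arc_complement[OF arcs[OF g]] by simp
    ultimately have "connected (- (path_image g \<union> ?T))"
      using Janiszewski_connected[OF compact_arc_image[OF arcs[OF g]] compact_imp_closed int _ con]
      by blast
    moreover have "path_image g \<union> ?T = (\<Union>h\<in>B. path_image h)" using g by blast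
    ultimately show ?thesis by simp
  qed
qed

context arc_system
begin

lemma frontier_face_subset:
  assumes F: "F \<in> components (- drawn P A)"
  shows "frontier F \<subseteq> drawn P A"
proof
  fix z assume z: "z \<in> frontier F"
  show "z \<in> drawn P A"
  proof (rule ccontr)
    assume "z \<notin> drawn P A"
    then have zX: "z \<in> - drawn P A" by simp
    let ?C = "connected_component_set (- drawn P A) z"
    have C: "?C \<in> components (- drawn P A)" using zX by (rule componentsI)
    have "z \<in> ?C" using zX by simp
    moreover have "z \<in> closure F" "z \<notin> F"
      using z interior_open[OF face_open[OF F]] by (auto simp: frontier_def)
    ultimately have "?C \<inter> F \<noteq> {}" "?C \<noteq> F"
      using open_Int_closure_eq_empty[OF face_open[OF C], of F] by blast+
    then show False using components_eq[OF C F] by blast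
  qed
qed

text \<open>The frontier of \<open>F\<close> lies on \<open>P\<close> and the touched arcs
  \<open>B\<close>. If \<open>B\<close> has at most three arcs, the complement of
  \<open>drawn P B\<close> is connected and hence contained in \<open>F\<close>. But
  \<open>4 \<le> card A\<close> provides an arc outside \<open>B\<close>, and its inner points would
  lie in \<open>F\<close>.\<close>

lemma face_touches_four_arcs:
  assumes bip: "inj_on (\<lambda>g. (pathstart g, pathfinish g)) A" "pathstart ` A \<inter> pathfinish ` A = {}"
    and four: "4 \<le> card A" and F: "F \<in> components (- drawn P A)"
  shows "4 \<le> card {g \<in> A. arc_inner g \<inter> closure F \<noteq> {}}"
proof (rule ccontr)
  define B where "B = {g \<in> A. arc_inner g \<inter> closure F \<noteq> {}}"
  assume "\<not> ?thesis"
  then have B3: "card B \<le> 3" by (simp add: B_def)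
  have BA: "B \<subseteq> A" by (auto simp: B_def)
  interpret B: arc_system P B by (rule arc_system_subset[OF arc_system_axioms BA])
  have con: "connected (- (\<Union>g\<in>B. path_image g))"
  proof (rule connected_complement_few_bipartite_arcs[OF B.arc_system_axioms _ _ B3])
    show "inj_on (\<lambda>g. (pathstart g, pathfinish g)) B" by (rule inj_on_subset[OF bip(1) BA])
    show "pathstart ` B \<inter> pathfinish ` B = {}" using bip(2) BA by blast
  qed
  have clo: "closed (\<Union>g\<in>B. path_image g)"
    using B.finite_A B.arcs closed_arc_image by (intro closed_UN) auto
  \<comment> \<open>The frontier may contain points of \<open>P\<close> that are on no arc of
    \<open>B\<close>; deleting finitely many points keeps a connected open subset of the plane
    connected.\<close>
  have "connected (- (\<Union>g\<in>B. path_image g) - P)"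
    by (rule connected_open_delete_finite[OF open_Compl[OF clo] con _ finite_P]) simp
  also have "- (\<Union>g\<in>B. path_image g) - P = - drawn P B"
    by (auto simp: drawn_def)
  finally have con': "connected (- drawn P B)" .
  have sub: "drawn P B \<subseteq> drawn P A" using BA by (auto simp: drawn_def)
  have FX: "F \<subseteq> - drawn P A" using F by (rule in_components_subset)
  have fr: "frontier F \<subseteq> drawn P B"
  proof
    fix z assume z: "z \<in> frontier F"
    then have "z \<in> drawn P A" "z \<in> closure F"
      using frontier_face_subset[OF F] by (auto simp: frontier_def)
    then consider "z \<in> P" | g where "g \<in> A" "z \<in> path_image g"
      by (auto simp: drawn_def)
    then show "z \<in> drawn P B"
    proof cases
      case 1
      then show ?thesis by (simp add: drawn_def)
    next
      case 2
      show ?thesis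
      proof (cases "z \<in> arc_inner g")
        case True
        then have "g \<in> B" using 2(1) \<open>z \<in> closure F\<close> by (auto simp: B_def)
        then show ?thesis using 2(2) by (auto simp: drawn_def)
      next
        case False
        then have "z \<in> P" using 2 ends by auto
        then show ?thesis by (simp add: drawn_def)
      qed
    qed
  qed
  have "- drawn P B \<subseteq> F"
  proof (rule ccontr)
    assume "\<not> - drawn P B \<subseteq> F"
    then have "- drawn P B - F \<noteq> {}" by blast
    moreover have "- drawn P B \<inter> F \<noteq> {}"
      using in_components_nonempty[OF F] FX sub by blast
    ultimately have "- drawn P B \<inter> frontier F \<noteq> {}"
      using connected_Int_frontier[OF con'] by blast
    then show False using fr by blast
  qed
  have "\<not> A \<subseteq> B"
    using four B3 card_mono[OF B.finite_A, of A] by linarith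
  then obtain g where g: "g \<in> A" "g \<notin> B" by blast
  obtain z where z: "z \<in> arc_inner g"
    using arc_inner_nonempty[OF arcs[OF g(1)]] by auto
  have "B \<subseteq> A - {g}" using g BA by blast
  then have "drawn P B \<subseteq> drawn P (A - {g})" by (auto simp: drawn_def)
  then have "z \<in> - drawn P B" using z inner_drawn_remove[OF g(1)] by blast
  then have "z \<in> F" using \<open>- drawn P B \<subseteq> F\<close> by blast
  then show False using FX z arc_subset_drawn[OF g(1)] by blast
qed

text \<open>Counting touching pairs in two ways gives \<open>2 * F \<le> E\<close>, and Euler's
  inequality with at least one class gives \<open>E + 2 \<le> F + V\<close>. Eliminating
  \<open>F\<close> leaves the bound.\<close>

lemma bipartite_arcs_bound:
  assumes bip: "inj_on (\<lambda>g. (pathstart g, pathfinish g)) A" "pathstart ` A \<inter> pathfinish ` A = {}"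
    and four: "4 \<le> card A"
  shows "card A + 4 \<le> 2 * card P"
proof -
  obtain \<F> where \<F>: "finite \<F>" "\<F> \<subseteq> components (- drawn P A)"
    "card A + 1 + n_classes P A \<le> card \<F> + card P"
    using euler_faces_classes[OF arc_system_axioms] by blast
  have "A \<noteq> {}" using four by auto
  then have "P \<noteq> {}" using ends by blast
  then have "1 \<le> n_classes P A"
    unfolding n_classes_def using finite_P by (simp add: Suc_le_eq card_gt_0_iff)
  have "4 * card \<F> = (\<Sum>F\<in>\<F>. 4)" by simp
  also have "\<dots> \<le> (\<Sum>F\<in>\<F>. card {g \<in> A. arc_inner g \<inter> closure F \<noteq> {}})"
    by (rule sum_mono) (use face_touches_four_arcs[OF bip four] \<F>(2) in blast)
  also have "\<dots> = (\<Sum>g\<in>A. card {F \<in> \<F>. arc_inner g \<inter> closure F \<noteq> {}})"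
    using sum_multicount_gen[OF \<F>(1) finite_A, of "\<lambda>F g. arc_inner g \<inter> closure F \<noteq> {}"] by simp
  also have "\<dots> \<le> (\<Sum>g\<in>A. 2)"
    by (rule sum_mono) (rule touches_at_most_two_faces[OF _ \<F>(2)])
  finally have "4 * card \<F> \<le> 2 * card A" by simp
  then show ?thesis using \<F>(3) \<open>1 \<le> n_classes P A\<close> by linarith
qed

end

section \<open>Straight-line drawings of Apollonian networks\<close>

text \<open>
  \<open>T\<close> contains the triangular faces that may still be subdivided. The outer face is not among them.
\<close>

inductive apollonian :: "'a set \<Rightarrow> 'a set set \<Rightarrow> 'a set set \<Rightarrow> bool" where
  triangle: "distinct [a, b, c] \<Longrightarrow> apollonian {a, b, c} {{a, b}, {a, c}, {b, c}} {{a, b, c}}"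
| stack: "apollonian V E T \<Longrightarrow> {a, b, c} \<in> T \<Longrightarrow> w \<notin> V \<Longrightarrow>
    apollonian (insert w V) (E \<union> {{w, a}, {w, b}, {w, c}})
      (T - {{a, b, c}} \<union> {{w, a, b}, {w, a, c}, {w, b, c}})"

section \<open>Barycentric coordinates and the centroid of a triangle\<close>

abbreviation open_triangle :: "complex set \<Rightarrow> complex set" where
  "open_triangle S \<equiv> interior (convex hull S)"

abbreviation relint_segment :: "complex set \<Rightarrow> complex set" where
  "relint_segment S \<equiv> convex hull S - S"

text \<open>The expression is twice the signed area of the triangle. In
  \<open>stack_centroid\<close> it shows that the new triangles are nondegenerate: up to sign, each
  has a third of the old area.\<close>

lemma collinear_iff_det:
  fixes a b c :: complex
  shows "collinear {a, b, c} \<longleftrightarrow> Re (b - a) * Im (c - a) - Im (b - a) * Re (c - a) = 0"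
proof
  assume "collinear {a, b, c}"
  then consider "a = c" | u where "b = u *\<^sub>R a + (1 - u) *\<^sub>R c"
    by (auto simp: collinear_3_expand)
  then show "Re (b - a) * Im (c - a) - Im (b - a) * Re (c - a) = 0"
  proof cases
    case 2
    show ?thesis unfolding 2 by (simp add: algebra_simps)
  qed simp
next
  assume det: "Re (b - a) * Im (c - a) - Im (b - a) * Re (c - a) = 0"
  show "collinear {a, b, c}"
  proof (cases "a = c")
    case False
    define u where "u = (b - c) / (a - c)"
    have "Im (b - c) * Re (a - c) - Re (b - c) * Im (a - c) = 0"
      using det by (simp add: algebra_simps)
    then have "Im u = 0" by (simp add: u_def Im_divide)
    then have u: "u = complex_of_real (Re u)" by (simp add: complex_eq_iff)
    have "b - c = u * (a - c)" using False by (simp add: u_def)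
    then have "b - c = Re u *\<^sub>R (a - c)" using u by (metis scaleR_conv_of_real)
    then have "b = Re u *\<^sub>R a + (1 - Re u) *\<^sub>R c"
      by (simp add: algebra_simps)
    then show ?thesis by (auto simp: collinear_3_expand)
  next
    case True
    then have "{a, b, c} = {b, c}" by auto
    then show ?thesis by simp
  qed
qed

text \<open>Cramer's rule for the differences of the coordinates. The disjointness statements in
  \<open>triangle_sides\<close> and \<open>stack_centroid\<close> become comparisons of coordinates
  through this lemma.\<close>

lemma barycentric_unique:
  fixes a b c :: complex
  assumes nc: "\<not> collinear {a, b, c}"
    and eq: "x *\<^sub>R a + y *\<^sub>R b + z *\<^sub>R c = x' *\<^sub>R a + y' *\<^sub>R b + z' *\<^sub>R c"
    and sum: "x + y + z = 1" "x' + y' + z' = 1"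
  shows "x = x'" "y = y'" "z = z'"
proof -
  define p q where "p = y - y'" and "q = z - z'"
  have x: "x = x' - p - q" using sum by (simp add: p_def q_def)
  have y: "y = y' + p" and z: "z = z' + q" by (simp_all add: p_def q_def)
  have re: "p * Re (b - a) + q * Re (c - a) = 0"
    using arg_cong[OF eq, of Re] unfolding x y z by (simp add: algebra_simps)
  have im: "p * Im (b - a) + q * Im (c - a) = 0"
    using arg_cong[OF eq, of Im] unfolding x y z by (simp add: algebra_simps)
  define d where "d = Re (b - a) * Im (c - a) - Im (b - a) * Re (c - a)"
  have "d \<noteq> 0" using nc unfolding collinear_iff_det d_def by simp
  moreover have "p * d = (p * Re (b - a) + q * Re (c - a)) * Im (c - a) -
      (p * Im (b - a) + q * Im (c - a)) * Re (c - a)"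
    by (simp add: d_def algebra_simps)
  moreover have "q * d = (p * Im (b - a) + q * Im (c - a)) * Re (b - a) -
      (p * Re (b - a) + q * Re (c - a)) * Im (b - a)"
    by (simp add: d_def algebra_simps)
  ultimately have "p = 0" "q = 0" using re im by auto
  then show "x = x'" "y = y'" "z = z'" using x y z by simp_all
qed

lemma open_triangle_iff:
  "\<not> collinear {a, b, c} \<Longrightarrow> v \<in> open_triangle {a, b, c} \<longleftrightarrow>
    (\<exists>x y z. 0 < x \<and> 0 < y \<and> 0 < z \<and> x + y + z = 1 \<and> v = x *\<^sub>R a + y *\<^sub>R b + z *\<^sub>R c)"
  by (subst interior_convex_hull_3_minimal) auto

lemma segment_hull_iff:
  "v \<in> convex hull {a, b} \<longleftrightarrow> (\<exists>t. 0 \<le> t \<and> t \<le> 1 \<and> v = t *\<^sub>R a + (1 - t) *\<^sub>R (b::complex))"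
  by (force simp: convex_hull_2)

lemma triangle_sides:
  fixes a b c :: complex
  assumes nc: "\<not> collinear {a, b, c}"
  shows "c \<notin> convex hull {a, b}"
    and "relint_segment {a, b} \<inter> convex hull {a, c} = {}"
    and "open_triangle {a, b, c} \<inter> convex hull {a, b} = {}"
    and "open_triangle {a, b, c} \<inter> {a, b, c} = {}"
proof -
  note u = barycentric_unique[OF nc]
  have ab: "\<exists>t. 0 \<le> t \<and> t \<le> 1 \<and> v = t *\<^sub>R a + (1 - t) *\<^sub>R b + 0 *\<^sub>R c" if "v \<in> convex hull {a, b}" for v
    using that by (auto simp: segment_hull_iff)
  have ac: "\<exists>t. 0 \<le> t \<and> t \<le> 1 \<and> v = t *\<^sub>R a + 0 *\<^sub>R b + (1 - t) *\<^sub>R c" if "v \<in> convex hull {a, c}" for v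
    using that by (auto simp: segment_hull_iff)
  show "c \<notin> convex hull {a, b}"
  proof
    assume "c \<in> convex hull {a, b}"
    then obtain t where "c = t *\<^sub>R a + (1 - t) *\<^sub>R b + 0 *\<^sub>R c" using ab by blast
    then have "0 *\<^sub>R a + 0 *\<^sub>R b + 1 *\<^sub>R c = t *\<^sub>R a + (1 - t) *\<^sub>R b + 0 *\<^sub>R c" by simp
    from u(3)[OF this] show False by simp
  qed
  show "relint_segment {a, b} \<inter> convex hull {a, c} = {}"
  proof (rule ccontr)
    assume "\<not> ?thesis"
    then obtain v where v: "v \<in> convex hull {a, b}" "v \<noteq> a" "v \<in> convex hull {a, c}" by blast
    obtain t where t: "v = t *\<^sub>R a + (1 - t) *\<^sub>R b + 0 *\<^sub>R c" using ab[OF v(1)] by blast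
    obtain s where s: "v = s *\<^sub>R a + 0 *\<^sub>R b + (1 - s) *\<^sub>R c" using ac[OF v(3)] by blast
    have "1 - t = 0" by (rule u(2)[OF t[symmetric, unfolded s]]) simp_all
    then show False using t v(2) by simp
  qed
  show "open_triangle {a, b, c} \<inter> convex hull {a, b} = {}"
  proof (rule ccontr)
    assume "\<not> ?thesis"
    then obtain v where v: "v \<in> convex hull {a, b}" "v \<in> open_triangle {a, b, c}" by blast
    obtain t where t: "v = t *\<^sub>R a + (1 - t) *\<^sub>R b + 0 *\<^sub>R c" using ab[OF v(1)] by blast
    obtain x y z where z: "0 < z" "x + y + z = 1" "v = x *\<^sub>R a + y *\<^sub>R b + z *\<^sub>R c"
      using v(2) unfolding open_triangle_iff[OF nc] by blast
    have "z = 0" by (rule u(3)[OF z(3)[symmetric, unfolded t] z(2)]) simp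
    then show False using z(1) by simp
  qed
  then have "a \<notin> open_triangle {a, b, c}" "b \<notin> open_triangle {a, b, c}"
    using hull_subset[of "{a, b}" convex] by blast+
  moreover have "c \<notin> open_triangle {a, b, c}"
  proof
    assume "c \<in> open_triangle {a, b, c}"
    then obtain x y z where z: "0 < x" "x + y + z = 1" "c = x *\<^sub>R a + y *\<^sub>R b + z *\<^sub>R c"
      unfolding open_triangle_iff[OF nc] by blast
    then have "0 *\<^sub>R a + 0 *\<^sub>R b + 1 *\<^sub>R c = x *\<^sub>R a + y *\<^sub>R b + z *\<^sub>R c" by simp
    from u(1)[OF this] z show False by simp
  qed
  ultimately show "open_triangle {a, b, c} \<inter> {a, b, c} = {}" by blast
qed

text \<open>In coordinates with respect to \<open>a\<close>, \<open>b\<close>, \<open>c\<close>, the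
  open triangle \<open>wab\<close> lies where the third coordinate is strictly the least and
  \<open>wac\<close> where the second is, while on the segment \<open>wc\<close> the third
  coordinate is at least the other two. This separates the sets.\<close>

lemma stack_centroid:
  fixes a b c :: complex
  assumes nc: "\<not> collinear {a, b, c}" and w: "w = (1/3) *\<^sub>R a + (1/3) *\<^sub>R b + (1/3) *\<^sub>R c"
  shows "w \<in> open_triangle {a, b, c}"
    and "convex hull {w, a} \<subseteq> insert a (open_triangle {a, b, c})"
    and "convex hull {w, a} \<inter> convex hull {w, b} \<subseteq> {w}"
    and "\<not> collinear {w, a, b}"
    and "open_triangle {w, a, b} \<subseteq> open_triangle {a, b, c}"
    and "open_triangle {w, a, b} \<inter> convex hull {w, c} = {}"
    and "open_triangle {w, a, b} \<inter> open_triangle {w, a, c} = {}"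
proof -
  note u = barycentric_unique[OF nc]
  show "w \<in> open_triangle {a, b, c}"
    unfolding open_triangle_iff[OF nc] w by (intro exI[of _ "1/3"]) simp
  have wa: "\<exists>t. 0 \<le> t \<and> t \<le> 1 \<and> v = (1 - 2 * t / 3) *\<^sub>R a + (t / 3) *\<^sub>R b + (t / 3) *\<^sub>R c"
    if v: "v \<in> convex hull {w, a}" for v
  proof -
    obtain t where t: "0 \<le> t" "t \<le> 1" "v = t *\<^sub>R w + (1 - t) *\<^sub>R a"
      using v unfolding segment_hull_iff by blast
    have "v = (1 - 2 * t / 3) *\<^sub>R a + (t / 3) *\<^sub>R b + (t / 3) *\<^sub>R c"
      unfolding t(3) w by (simp add: complex_eq_iff algebra_simps)
    then show ?thesis using t by blast
  qed
  have wb: "\<exists>t. 0 \<le> t \<and> t \<le> 1 \<and> v = (t / 3) *\<^sub>R a + (1 - 2 * t / 3) *\<^sub>R b + (t / 3) *\<^sub>R c"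
    if v: "v \<in> convex hull {w, b}" for v
  proof -
    obtain t where t: "0 \<le> t" "t \<le> 1" "v = t *\<^sub>R w + (1 - t) *\<^sub>R b"
      using v unfolding segment_hull_iff by blast
    have "v = (t / 3) *\<^sub>R a + (1 - 2 * t / 3) *\<^sub>R b + (t / 3) *\<^sub>R c"
      unfolding t(3) w by (simp add: complex_eq_iff algebra_simps)
    then show ?thesis using t by blast
  qed
  have wc: "\<exists>t. 0 \<le> t \<and> t \<le> 1 \<and> v = (t / 3) *\<^sub>R a + (t / 3) *\<^sub>R b + (1 - 2 * t / 3) *\<^sub>R c"
    if v: "v \<in> convex hull {w, c}" for v
  proof -
    obtain t where t: "0 \<le> t" "t \<le> 1" "v = t *\<^sub>R w + (1 - t) *\<^sub>R c"
      using v unfolding segment_hull_iff by blast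
    have "v = (t / 3) *\<^sub>R a + (t / 3) *\<^sub>R b + (1 - 2 * t / 3) *\<^sub>R c"
      unfolding t(3) w by (simp add: complex_eq_iff algebra_simps)
    then show ?thesis using t by blast
  qed
  show "convex hull {w, a} \<subseteq> insert a (open_triangle {a, b, c})"
  proof
    fix v assume "v \<in> convex hull {w, a}"
    then obtain t where t: "0 \<le> t" "t \<le> 1" "v = (1 - 2 * t / 3) *\<^sub>R a + (t / 3) *\<^sub>R b + (t / 3) *\<^sub>R c"
      using wa by blast
    show "v \<in> insert a (open_triangle {a, b, c})"
    proof (cases "t = 0")
      case True
      then show ?thesis using t(3) by simp
    next
      case False
      then have "v \<in> open_triangle {a, b, c}"
        unfolding open_triangle_iff[OF nc] t(3) using t(1,2)
        by (intro exI[of _ "1 - 2 * t / 3"] exI[of _ "t / 3"]) simp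
      then show ?thesis by simp
    qed
  qed
  show "convex hull {w, a} \<inter> convex hull {w, b} \<subseteq> {w}"
  proof
    fix v assume "v \<in> convex hull {w, a} \<inter> convex hull {w, b}"
    then obtain t s where t: "v = (1 - 2 * t / 3) *\<^sub>R a + (t / 3) *\<^sub>R b + (t / 3) *\<^sub>R c"
      and s: "v = (s / 3) *\<^sub>R a + (1 - 2 * s / 3) *\<^sub>R b + (s / 3) *\<^sub>R c"
      using wa wb by blast
    note e = u[OF t[symmetric, unfolded s]]
    have "1 - 2 * t / 3 = s / 3" by (rule e(1)) simp_all
    moreover have "t / 3 = s / 3" by (rule e(3)) simp_all
    ultimately have "t = 1" by simp
    then show "v \<in> {w}" unfolding t w by simp
  qed
  have "Re (a - w) * Im (b - w) - Im (a - w) * Re (b - w) =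
      (Re (b - a) * Im (c - a) - Im (b - a) * Re (c - a)) / 3"
    unfolding w by (simp add: field_simps)
  then show nc': "\<not> collinear {w, a, b}"
    using nc unfolding collinear_iff_det by simp
  have "Re (a - w) * Im (c - w) - Im (a - w) * Re (c - w) =
      - (Re (b - a) * Im (c - a) - Im (b - a) * Re (c - a)) / 3"
    unfolding w by (simp add: field_simps)
  then have nc'': "\<not> collinear {w, a, c}"
    using nc unfolding collinear_iff_det by simp
  have wab: "\<exists>x y z. 0 < x \<and> 0 < y \<and> 0 < z \<and> x + y + z = 1 \<and>
      v = (y + x / 3) *\<^sub>R a + (z + x / 3) *\<^sub>R b + (x / 3) *\<^sub>R c"
    if v: "v \<in> open_triangle {w, a, b}" for v
  proof -
    obtain x y z where x: "0 < x" "0 < y" "0 < z" "x + y + z = 1" "v = x *\<^sub>R w + y *\<^sub>R a + z *\<^sub>R b"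
      using v unfolding open_triangle_iff[OF nc'] by blast
    have "v = (y + x / 3) *\<^sub>R a + (z + x / 3) *\<^sub>R b + (x / 3) *\<^sub>R c"
      unfolding x(5) w by (simp add: complex_eq_iff algebra_simps)
    then show ?thesis using x by blast
  qed
  have wac: "\<exists>x y z. 0 < x \<and> 0 < y \<and> 0 < z \<and> x + y + z = 1 \<and>
      v = (y + x / 3) *\<^sub>R a + (x / 3) *\<^sub>R b + (z + x / 3) *\<^sub>R c"
    if v: "v \<in> open_triangle {w, a, c}" for v
  proof -
    obtain x y z where x: "0 < x" "0 < y" "0 < z" "x + y + z = 1" "v = x *\<^sub>R w + y *\<^sub>R a + z *\<^sub>R c"
      using v unfolding open_triangle_iff[OF nc''] by blast
    have "v = (y + x / 3) *\<^sub>R a + (x / 3) *\<^sub>R b + (z + x / 3) *\<^sub>R c"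
      unfolding x(5) w by (simp add: complex_eq_iff algebra_simps)
    then show ?thesis using x by blast
  qed
  show "open_triangle {w, a, b} \<subseteq> open_triangle {a, b, c}"
  proof
    fix v assume "v \<in> open_triangle {w, a, b}"
    then obtain x y z where x: "0 < x" "0 < y" "0 < z" "x + y + z = 1"
      "v = (y + x / 3) *\<^sub>R a + (z + x / 3) *\<^sub>R b + (x / 3) *\<^sub>R c"
      using wab by blast
    show "v \<in> open_triangle {a, b, c}"
      unfolding open_triangle_iff[OF nc] x(5) using x(1-4)
      by (intro exI[of _ "y + x / 3"] exI[of _ "z + x / 3"] exI[of _ "x / 3"]) simp
  qed
  show "open_triangle {w, a, b} \<inter> convex hull {w, c} = {}"
  proof (rule ccontr)
    assume "\<not> ?thesis"
    then obtain v where v: "v \<in> open_triangle {w, a, b}" "v \<in> convex hull {w, c}" by blast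
    obtain x y z where x: "0 < x" "0 < y" "0 < z" "x + y + z = 1"
      "v = (y + x / 3) *\<^sub>R a + (z + x / 3) *\<^sub>R b + (x / 3) *\<^sub>R c"
      using wab[OF v(1)] by blast
    obtain t where t: "0 \<le> t" "t \<le> 1" "v = (t / 3) *\<^sub>R a + (t / 3) *\<^sub>R b + (1 - 2 * t / 3) *\<^sub>R c"
      using wc[OF v(2)] by blast
    note e = u[OF x(5)[symmetric, unfolded t(3)]]
    have "y + x / 3 = t / 3" by (rule e(1)) (use x(4) in simp_all)
    moreover have "x / 3 = 1 - 2 * t / 3" by (rule e(3)) (use x(4) in simp_all)
    ultimately show False using x(1-4) t(1,2) by linarith
  qed
  show "open_triangle {w, a, b} \<inter> open_triangle {w, a, c} = {}"
  proof (rule ccontr)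
    assume "\<not> ?thesis"
    then obtain v where v: "v \<in> open_triangle {w, a, b}" "v \<in> open_triangle {w, a, c}" by blast
    obtain x y z where x: "0 < x" "0 < y" "0 < z" "x + y + z = 1"
      "v = (y + x / 3) *\<^sub>R a + (z + x / 3) *\<^sub>R b + (x / 3) *\<^sub>R c"
      using wab[OF v(1)] by blast
    obtain x' y' z' where x': "0 < x'" "0 < y'" "0 < z'" "x' + y' + z' = 1"
      "v = (y' + x' / 3) *\<^sub>R a + (x' / 3) *\<^sub>R b + (z' + x' / 3) *\<^sub>R c"
      using wac[OF v(2)] by blast
    note e = u[OF x(5)[symmetric, unfolded x'(5)]]
    have "z + x / 3 = x' / 3" by (rule e(2)) (use x(4) x'(4) in simp_all)
    moreover have "x / 3 = z' + x' / 3" by (rule e(3)) (use x(4) x'(4) in simp_all)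
    ultimately show False using x(1-4) x'(1-4) by linarith
  qed
qed


section \<open>Straight-line drawings and their extension by stacking\<close>

text \<open>The clauses on \<open>E\<close> are those of \<open>plane_drawing\<close> for segments.
  The clauses on \<open>T\<close> are the invariant that permits further stacking: an available
  triangle is nondegenerate, and its interior is free of points, edges and other available
  triangles.\<close>

definition straight_drawing :: "('a \<Rightarrow> complex) \<Rightarrow> 'a set \<Rightarrow> 'a set set \<Rightarrow> 'a set set \<Rightarrow> bool" where
  "straight_drawing p V E T \<longleftrightarrow>
     inj_on p V \<and>
     (\<forall>e\<in>E. e \<subseteq> V \<and> relint_segment (p ` e) \<inter> p ` V = {} \<and>
       (\<forall>f\<in>E. e \<noteq> f \<longrightarrow> relint_segment (p ` e) \<inter> convex hull (p ` f) = {})) \<and>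
     (\<forall>F\<in>T. F \<subseteq> V \<and> \<not> collinear (p ` F) \<and> open_triangle (p ` F) \<inter> p ` V = {} \<and>
       (\<forall>e\<in>E. open_triangle (p ` F) \<inter> convex hull (p ` e) = {}) \<and>
       (\<forall>F'\<in>T. F \<noteq> F' \<longrightarrow> open_triangle (p ` F) \<inter> open_triangle (p ` F') = {}))"

lemma straight_drawingD:
  assumes "straight_drawing p V E T"
  shows "inj_on p V"
    and "e \<in> E \<Longrightarrow> e \<subseteq> V"
    and "e \<in> E \<Longrightarrow> relint_segment (p ` e) \<inter> p ` V = {}"
    and "\<lbrakk>e \<in> E; f \<in> E; e \<noteq> f\<rbrakk> \<Longrightarrow> relint_segment (p ` e) \<inter> convex hull (p ` f) = {}"
    and "F \<in> T \<Longrightarrow> F \<subseteq> V"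
    and "F \<in> T \<Longrightarrow> \<not> collinear (p ` F)"
    and "F \<in> T \<Longrightarrow> open_triangle (p ` F) \<inter> p ` V = {}"
    and "\<lbrakk>F \<in> T; e \<in> E\<rbrakk> \<Longrightarrow> open_triangle (p ` F) \<inter> convex hull (p ` e) = {}"
    and "\<lbrakk>F \<in> T; F' \<in> T; F \<noteq> F'\<rbrakk> \<Longrightarrow> open_triangle (p ` F) \<inter> open_triangle (p ` F') = {}"
proof -
  note d = assms[unfolded straight_drawing_def]
  note E = d[THEN conjunct2, THEN conjunct1, THEN bspec]
  note T = d[THEN conjunct2, THEN conjunct2, THEN bspec]
  show "inj_on p V"
    by (rule d[THEN conjunct1])
  show "e \<in> E \<Longrightarrow> e \<subseteq> V"
    by (rule E[THEN conjunct1])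
  show "e \<in> E \<Longrightarrow> relint_segment (p ` e) \<inter> p ` V = {}"
    by (rule E[THEN conjunct2, THEN conjunct1])
  show "\<lbrakk>e \<in> E; f \<in> E; e \<noteq> f\<rbrakk> \<Longrightarrow> relint_segment (p ` e) \<inter> convex hull (p ` f) = {}"
    by (rule E[THEN conjunct2, THEN conjunct2, THEN bspec, THEN mp])
  show "F \<in> T \<Longrightarrow> F \<subseteq> V"
    by (rule T[THEN conjunct1])
  show "F \<in> T \<Longrightarrow> \<not> collinear (p ` F)"
    by (rule T[THEN conjunct2, THEN conjunct1])
  show "F \<in> T \<Longrightarrow> open_triangle (p ` F) \<inter> p ` V = {}"
    by (rule T[THEN conjunct2, THEN conjunct2, THEN conjunct1])
  show "\<lbrakk>F \<in> T; e \<in> E\<rbrakk> \<Longrightarrow> open_triangle (p ` F) \<inter> convex hull (p ` e) = {}"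
    by (rule T[THEN conjunct2, THEN conjunct2, THEN conjunct2, THEN conjunct1, THEN bspec])
  show "\<lbrakk>F \<in> T; F' \<in> T; F \<noteq> F'\<rbrakk> \<Longrightarrow> open_triangle (p ` F) \<inter> open_triangle (p ` F') = {}"
    by (rule T[THEN conjunct2, THEN conjunct2, THEN conjunct2, THEN conjunct2, THEN bspec, THEN mp])
qed

lemma straight_drawing_triangle:
  assumes d: "distinct [a, b, c]"
  shows "\<exists>p. straight_drawing p {a, b, c} {{a, b}, {a, c}, {b, c}} {{a, b, c}}"
proof -
  define p where "p = (\<lambda>_. 0)(b := 1, c := \<i>)"
  have p: "p a = 0" "p b = 1" "p c = \<i>"
    using d by (auto simp: p_def)
  have nc: "\<not> collinear {p a, p b, p c}"
    unfolding collinear_iff_det p by simp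
  \<comment> \<open>The drawing speaks of sets of corners, whereas \<open>triangle_sides\<close>
    depends on their order; its six instances are brought to one normal form.\<close>
  have perm: "{p a, p c, p b} = {p a, p b, p c}" "{p b, p c, p a} = {p a, p b, p c}"
    "{p b, p a, p c} = {p a, p b, p c}" "{p c, p a, p b} = {p a, p b, p c}"
    "{p c, p b, p a} = {p a, p b, p c}"
    by auto
  have swap: "{p b, p a} = {p a, p b}" "{p c, p a} = {p a, p c}" "{p c, p b} = {p b, p c}"
    by auto
  note s = triangle_sides[of "p a" "p b" "p c", unfolded perm swap, OF nc]
    triangle_sides[of "p a" "p c" "p b", unfolded perm swap, OF nc]
    triangle_sides[of "p b" "p a" "p c", unfolded perm swap, OF nc]
    triangle_sides[of "p b" "p c" "p a", unfolded perm swap, OF nc]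
    triangle_sides[of "p c" "p a" "p b", unfolded perm swap, OF nc]
    triangle_sides[of "p c" "p b" "p a", unfolded perm swap, OF nc]
  have "inj_on p {a, b, c}" using d p by auto
  then have "straight_drawing p {a, b, c} {{a, b}, {a, c}, {b, c}} {{a, b, c}}"
    unfolding straight_drawing_def ball_simps image_insert image_empty
    using s nc by blast
  then show ?thesis by blast
qed

text \<open>The centroid is a third of the sum over the set of corners, so
  \<open>stack_centroid\<close> applies to the corners in any order.\<close>

lemma stack_centroid_all:
  fixes a b c :: complex
  assumes nc: "\<not> collinear {a, b, c}" and w: "w = (1/3) *\<^sub>R a + (1/3) *\<^sub>R b + (1/3) *\<^sub>R c"
    and xyz: "{x, y, z} = {a, b, c}" "distinct [x, y, z]"
  shows "convex hull {w, x} \<subseteq> insert x (open_triangle {a, b, c})"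
    and "convex hull {w, x} \<inter> convex hull {w, y} \<subseteq> {w}"
    and "\<not> collinear {w, x, y}"
    and "open_triangle {w, x, y} \<subseteq> open_triangle {a, b, c}"
    and "open_triangle {w, x, y} \<inter> convex hull {w, z} = {}"
    and "open_triangle {w, x, y} \<inter> open_triangle {w, x, z} = {}"
proof -
  have "distinct [a, b, c]"
    using nc by (auto simp: insert_commute)
  then have "w = (1/3) *\<^sub>R \<Sum>{a, b, c}"
    unfolding w by (simp add: scaleR_right_distrib)
  then have "w = (1/3) *\<^sub>R x + (1/3) *\<^sub>R y + (1/3) *\<^sub>R z"
    unfolding xyz(1)[symmetric] using xyz(2) by (simp add: scaleR_right_distrib)
  note s = stack_centroid[OF _ this, unfolded xyz(1), OF nc]
  show "convex hull {w, x} \<subseteq> insert x (open_triangle {a, b, c})"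
    "convex hull {w, x} \<inter> convex hull {w, y} \<subseteq> {w}"
    "\<not> collinear {w, x, y}"
    "open_triangle {w, x, y} \<subseteq> open_triangle {a, b, c}"
    "open_triangle {w, x, y} \<inter> convex hull {w, z} = {}"
    "open_triangle {w, x, y} \<inter> open_triangle {w, x, z} = {}"
    by (rule s(2), rule s(3), rule s(4), rule s(5), rule s(6), rule s(7))
qed

locale apollonian_stack =
  fixes p :: "'a \<Rightarrow> complex" and V :: "'a set" and E T :: "'a set set" and a b c w :: 'a
  assumes drawing: "straight_drawing p V E T" and face: "{a, b, c} \<in> T" and new: "w \<notin> V"
begin

definition W :: complex where "W = (1/3) *\<^sub>R p a + (1/3) *\<^sub>R p b + (1/3) *\<^sub>R p c"

definition q :: "'a \<Rightarrow> complex" where "q = p(w := W)"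

abbreviation new_edges :: "'a set set" where
  "new_edges \<equiv> {{w, a}, {w, b}, {w, c}}"

abbreviation new_faces :: "'a set set" where
  "new_faces \<equiv> {{w, a, b}, {w, a, c}, {w, b, c}}"

abbreviation \<Delta> :: "complex set" where
  "\<Delta> \<equiv> open_triangle {p a, p b, p c}"

lemmas D = straight_drawingD[OF drawing]

lemma noncollinear: "\<not> collinear {p a, p b, p c}"
  using D(6)[OF face] by simp

lemma abc_V: "{a, b, c} \<subseteq> V"
  by (rule D(5)[OF face])

lemma \<Delta>_V: "\<Delta> \<inter> p ` V = {}"
  using D(7)[OF face] by (simp only: image_insert image_empty)

lemma \<Delta>_E: "e \<in> E \<Longrightarrow> \<Delta> \<inter> convex hull (p ` e) = {}"
  using D(8)[OF face] by (simp only: image_insert image_empty)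

lemma \<Delta>_T: "F \<in> T \<Longrightarrow> {a, b, c} \<noteq> F \<Longrightarrow> \<Delta> \<inter> open_triangle (p ` F) = {}"
  using D(9)[OF face] by (simp only: image_insert image_empty)

lemma distinct_p: "p a \<noteq> p b" "p a \<noteq> p c" "p b \<noteq> p c"
  using noncollinear by (auto simp: insert_commute)

lemma q_w: "q w = W"
  by (simp add: q_def)

lemma q_old: "v \<in> V \<Longrightarrow> q v = p v"
  using new by (auto simp: q_def)

lemma q_image_old: "S \<subseteq> V \<Longrightarrow> q ` S = p ` S"
  by (rule image_cong[OF refl]) (use q_old in blast)

lemma q_image_insert: "S \<subseteq> V \<Longrightarrow> q ` insert w S = insert W (p ` S)"
  by (simp add: q_w q_image_old)

lemma W_\<Delta>: "W \<in> \<Delta>"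
  by (rule stack_centroid(1)[OF noncollinear W_def])

lemma W_notin: "W \<notin> p ` V"
  using W_\<Delta> \<Delta>_V by blast

lemma inj_q: "inj_on q (insert w V)"
proof -
  have "inj_on q V"
    using D(1) q_old by (metis inj_on_cong)
  then show ?thesis
    using W_notin q_image_old[of V] q_w by (auto simp: inj_on_insert)
qed

lemmas centroid = stack_centroid_all[OF noncollinear W_def]

text \<open>With two arbitrary corners completed to all three, each fact about new edges and faces
  gets one proof instead of one for every side.\<close>

lemma third_corner:
  assumes "x \<in> {a, b, c}" "y \<in> {a, b, c}" "p x \<noteq> p y"
  obtains z where "z \<in> {a, b, c}" "{p x, p y, p z} = {p a, p b, p c}" "distinct [p x, p y, p z]"
proof -
  have "\<exists>z\<in>{a, b, c}. {p x, p y, p z} = {p a, p b, p c} \<and> distinct [p x, p y, p z]"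
    using assms distinct_p by (auto simp: insert_commute)
  then show thesis using that by blast
qed

lemma other_corner:
  assumes "x \<in> {a, b, c}"
  obtains y where "y \<in> {a, b, c}" "p x \<noteq> p y"
proof -
  have "\<exists>y\<in>{a, b, c}. p x \<noteq> p y"
    using assms distinct_p by auto
  then show thesis using that by blast
qed

text \<open>Apart from old corners everything new lies in \<open>\<Delta>\<close>, and
  \<open>\<Delta>\<close> avoids everything old. In \<open>stacked_edges\<close> and
  \<open>stacked_faces\<close> this settles the comparisons of old with new; for new with new the
  centroid computations are used.\<close>

lemma new_segment:
  assumes "x \<in> {a, b, c}"
  shows "convex hull {W, p x} \<subseteq> insert (p x) \<Delta>"
proof -
  obtain y where y: "y \<in> {a, b, c}" "p x \<noteq> p y" by (rule other_corner[OF assms])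
  obtain z where z: "{p x, p y, p z} = {p a, p b, p c}" "distinct [p x, p y, p z]"
    by (rule third_corner[OF assms y])
  show ?thesis by (rule centroid(1)[OF z])
qed

lemma new_segments_Int:
  assumes "x \<in> {a, b, c}" "y \<in> {a, b, c}" "p x \<noteq> p y"
  shows "convex hull {W, p x} \<inter> convex hull {W, p y} \<subseteq> {W}"
proof -
  obtain z where z: "{p x, p y, p z} = {p a, p b, p c}" "distinct [p x, p y, p z]"
    by (rule third_corner[OF assms])
  show ?thesis by (rule centroid(2)[OF z])
qed

lemma new_triangle:
  assumes "x \<in> {a, b, c}" "y \<in> {a, b, c}" "p x \<noteq> p y"
  shows "\<not> collinear {W, p x, p y}" and "open_triangle {W, p x, p y} \<subseteq> \<Delta>"
proof -
  obtain z where z: "{p x, p y, p z} = {p a, p b, p c}" "distinct [p x, p y, p z]"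
    by (rule third_corner[OF assms])
  show "\<not> collinear {W, p x, p y}" by (rule centroid(3)[OF z])
  show "open_triangle {W, p x, p y} \<subseteq> \<Delta>" by (rule centroid(4)[OF z])
qed

lemma new_triangle_segment:
  assumes xy: "x \<in> {a, b, c}" "y \<in> {a, b, c}" "p x \<noteq> p y" and v: "v \<in> {a, b, c}"
  shows "open_triangle {W, p x, p y} \<inter> convex hull {W, p v} = {}"
proof -
  obtain z where z: "{p x, p y, p z} = {p a, p b, p c}" "distinct [p x, p y, p z]"
    by (rule third_corner[OF xy])
  have "open_triangle {W, p x, p y} \<inter> convex hull {W, p x} = {}"
    by (rule triangle_sides(3)[OF new_triangle(1)[OF xy]])
  moreover have "open_triangle {W, p y, p x} \<inter> convex hull {W, p y} = {}"
    by (rule triangle_sides(3)[OF new_triangle(1)[OF xy(2,1) xy(3)[symmetric]]])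
  moreover have "{W, p y, p x} = {W, p x, p y}" by blast
  moreover have "open_triangle {W, p x, p y} \<inter> convex hull {W, p z} = {}"
    by (rule centroid(5)[OF z])
  moreover have "p v \<in> {p x, p y, p z}" unfolding z(1) using v by blast
  ultimately show ?thesis by auto
qed

lemma new_triangles_disjoint:
  assumes xy: "x \<in> {a, b, c}" "y \<in> {a, b, c}" "p x \<noteq> p y"
    and xy': "x' \<in> {a, b, c}" "y' \<in> {a, b, c}" "p x' \<noteq> p y'"
    and ne: "{W, p x, p y} \<noteq> {W, p x', p y'}"
  shows "open_triangle {W, p x, p y} \<inter> open_triangle {W, p x', p y'} = {}"
proof -
  obtain z where z: "{p x, p y, p z} = {p a, p b, p c}" "distinct [p x, p y, p z]"
    by (rule third_corner[OF xy])
  have z': "{p y, p x, p z} = {p a, p b, p c}" "distinct [p y, p x, p z]"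
    using z by auto
  have "p x' \<in> {p x, p y, p z}" "p y' \<in> {p x, p y, p z}"
    unfolding z(1) using xy' by blast+
  then have "{W, p x', p y'} = {W, p x, p z} \<or> {W, p x', p y'} = {W, p y, p z}"
    using xy'(3) ne by (elim insertE emptyE; simp add: insert_commute)
  moreover have "open_triangle {W, p x, p y} \<inter> open_triangle {W, p x, p z} = {}"
    by (rule centroid(6)[OF z])
  moreover have "open_triangle {W, p y, p x} \<inter> open_triangle {W, p y, p z} = {}"
    by (rule centroid(6)[OF z'])
  moreover have "{W, p y, p x} = {W, p x, p y}" by blast
  ultimately show ?thesis by (elim disjE) simp_all
qed

lemma edge_cases:
  assumes "e \<in> E \<union> new_edges"
  obtains (old) "e \<in> E" "q ` e = p ` e"
  | (new) v where "v \<in> {a, b, c}" "e = {w, v}" "q ` e = {W, p v}"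
proof (cases "e \<in> E")
  case True
  show ?thesis by (rule old[OF True q_image_old[OF D(2)[OF True]]])
next
  case False
  then obtain v where v: "v \<in> {a, b, c}" "e = {w, v}" using assms by blast
  moreover have "q ` e = {W, p v}"
    unfolding v(2) using q_image_insert[of "{v}"] v(1) abc_V by auto
  ultimately show ?thesis by (rule new)
qed

lemma face_cases:
  assumes "F \<in> T - {{a, b, c}} \<union> new_faces"
  obtains (old) "F \<in> T" "{a, b, c} \<noteq> F" "q ` F = p ` F"
  | (new) x y where "x \<in> {a, b, c}" "y \<in> {a, b, c}" "p x \<noteq> p y" "F = {w, x, y}" "q ` F = {W, p x, p y}"
proof (cases "F \<in> new_faces")
  case False
  then have F: "F \<in> T" "{a, b, c} \<noteq> F" using assms by blast+
  show ?thesis by (rule old[OF F q_image_old[OF D(5)[OF F(1)]]])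
next
  case True
  then obtain x y where xy: "x \<in> {a, b, c}" "y \<in> {a, b, c}" "p x \<noteq> p y" "F = {w, x, y}"
    using distinct_p by blast
  moreover have "q ` F = {W, p x, p y}"
    unfolding xy(4) using q_image_insert[of "{x, y}"] xy(1,2) abc_V by auto
  ultimately show ?thesis by (rule new)
qed

lemma stacked_edges:
  assumes e: "e \<in> E \<union> new_edges"
  shows "relint_segment (q ` e) \<inter> q ` insert w V = {}"
    and "f \<in> E \<union> new_edges \<Longrightarrow> e \<noteq> f \<Longrightarrow> relint_segment (q ` e) \<inter> convex hull (q ` f) = {}"
proof -
  have qV: "q ` insert w V = insert W (p ` V)" by (rule q_image_insert) simp
  show "relint_segment (q ` e) \<inter> q ` insert w V = {}"
    using e
  proof (cases rule: edge_cases)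
    case old
    then show ?thesis
      unfolding old(2) qV using D(3)[OF old(1)] \<Delta>_E[OF old(1)] W_\<Delta> by blast
  next
    case (new v)
    show ?thesis
      unfolding new(3) qV using new_segment[OF new(1)] \<Delta>_V by blast
  qed
  assume f: "f \<in> E \<union> new_edges" and ne: "e \<noteq> f"
  show "relint_segment (q ` e) \<inter> convex hull (q ` f) = {}"
    using e
  proof (cases rule: edge_cases)
    case e: old
    show ?thesis
      using f
    proof (cases rule: edge_cases)
      case f: old
      show ?thesis unfolding e(2) f(2) by (rule D(4)[OF e(1) f(1) ne])
    next
      case (new v)
      have "p v \<in> p ` V" using new(1) abc_V by blast
      then show ?thesis
        unfolding e(2) new(3) using new_segment[OF new(1)] \<Delta>_E[OF e(1)] D(3)[OF e(1)] by blast
    qed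
  next
    case e: (new v)
    show ?thesis
      using f
    proof (cases rule: edge_cases)
      case f: old
      show ?thesis
        unfolding e(3) f(2) using new_segment[OF e(1)] \<Delta>_E[OF f(1)] by blast
    next
      case f: (new u)
      have "v \<noteq> u" using e(2) f(2) ne by blast
      then have "p v \<noteq> p u"
        using inj_onD[OF D(1), of v u] e(1) f(1) abc_V by blast
      then show ?thesis
        unfolding e(3) f(3) using new_segments_Int[OF e(1) f(1)] by blast
    qed
  qed
qed

lemma stacked_faces:
  assumes F: "F \<in> T - {{a, b, c}} \<union> new_faces"
  shows "\<not> collinear (q ` F)"
    and "open_triangle (q ` F) \<inter> q ` insert w V = {}"
    and "e \<in> E \<union> new_edges \<Longrightarrow> open_triangle (q ` F) \<inter> convex hull (q ` e) = {}"
    and "G \<in> T - {{a, b, c}} \<union> new_faces \<Longrightarrow> F \<noteq> G \<Longrightarrow>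
      open_triangle (q ` F) \<inter> open_triangle (q ` G) = {}"
proof -
  have qV: "q ` insert w V = insert W (p ` V)" by (rule q_image_insert) simp
  show "\<not> collinear (q ` F)"
    using F
  proof (cases rule: face_cases)
    case old
    show ?thesis unfolding old(3) by (rule D(6)[OF old(1)])
  next
    case (new x y)
    show ?thesis unfolding new(5) by (rule new_triangle(1)[OF new(1-3)])
  qed
  show "open_triangle (q ` F) \<inter> q ` insert w V = {}"
    using F
  proof (cases rule: face_cases)
    case old
    show ?thesis
      unfolding old(3) qV using D(7)[OF old(1)] \<Delta>_T[OF old(1,2)] W_\<Delta> by blast
  next
    case (new x y)
    have "W \<in> convex hull {W, p x}" by (simp add: hull_inc)
    then have "W \<notin> open_triangle {W, p x, p y}"
      using new_triangle_segment[OF new(1-3) new(1)] by blast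
    then show ?thesis
      unfolding new(5) qV using new_triangle(2)[OF new(1-3)] \<Delta>_V by blast
  qed
  show "open_triangle (q ` F) \<inter> convex hull (q ` e) = {}" if e: "e \<in> E \<union> new_edges"
    using F
  proof (cases rule: face_cases)
    case F: old
    show ?thesis using e
    proof (cases rule: edge_cases)
      case e: old
      show ?thesis unfolding F(3) e(2) by (rule D(8)[OF F(1) e(1)])
    next
      case (new v)
      have "p v \<in> p ` V" using new(1) abc_V by blast
      then show ?thesis
        unfolding F(3) new(3) using new_segment[OF new(1)] \<Delta>_T[OF F(1,2)] D(7)[OF F(1)] by blast
    qed
  next
    case F: (new x y)
    show ?thesis using e
    proof (cases rule: edge_cases)
      case e: old
      show ?thesis
        unfolding F(5) e(2) using new_triangle(2)[OF F(1-3)] \<Delta>_E[OF e(1)] by blast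
    next
      case (new v)
      show ?thesis unfolding F(5) new(3) by (rule new_triangle_segment[OF F(1-3) new(1)])
    qed
  qed
  show "open_triangle (q ` F) \<inter> open_triangle (q ` G) = {}"
    if G: "G \<in> T - {{a, b, c}} \<union> new_faces" and ne: "F \<noteq> G"
    using F
  proof (cases rule: face_cases)
    case F: old
    show ?thesis using G
    proof (cases rule: face_cases)
      case G: old
      show ?thesis unfolding F(3) G(3) by (rule D(9)[OF F(1) G(1) ne])
    next
      case (new x y)
      show ?thesis
        unfolding F(3) new(5) using new_triangle(2)[OF new(1-3)] \<Delta>_T[OF F(1,2)] by blast
    qed
  next
    case F: (new x y)
    show ?thesis using G
    proof (cases rule: face_cases)
      case G: old
      show ?thesis
        unfolding F(5) G(3) using new_triangle(2)[OF F(1-3)] \<Delta>_T[OF G(1,2)] by blast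
    next
      case G: (new x' y')
      have "F \<subseteq> insert w V" "G \<subseteq> insert w V"
        unfolding F(4) G(4) using F(1,2) G(1,2) abc_V by blast+
      then have "q ` F \<noteq> q ` G"
        using inj_on_image_eq_iff[OF inj_q] ne by blast
      then show ?thesis
        unfolding F(5) G(5) by (rule new_triangles_disjoint[OF F(1-3) G(1-3)])
    qed
  qed
qed

lemma straight_drawing_stack:
  "straight_drawing q (insert w V) (E \<union> new_edges) (T - {{a, b, c}} \<union> new_faces)"
  unfolding straight_drawing_def
proof (intro conjI ballI impI)
  show "inj_on q (insert w V)" by (rule inj_q)
  show "e \<subseteq> insert w V" if "e \<in> E \<union> new_edges" for e
    using that
  proof (cases rule: edge_cases)
    case old
    then show ?thesis using D(2) by blast
  next
    case (new v)
    then show ?thesis using abc_V by blast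
  qed
  show "F \<subseteq> insert w V" if "F \<in> T - {{a, b, c}} \<union> new_faces" for F
    using that
  proof (cases rule: face_cases)
    case old
    then show ?thesis using D(5) by blast
  next
    case (new x y)
    then show ?thesis using abc_V by blast
  qed
qed (fact stacked_edges stacked_faces)+

end

lemma apollonian_straight_drawing:
  "apollonian V E T \<Longrightarrow> \<exists>p. straight_drawing p V E T"
proof (induction rule: apollonian.induct)
  case (triangle a b c)
  then show ?case by (rule straight_drawing_triangle)
next
  case (stack V E T a b c w)
  then obtain p where "straight_drawing p V E T" by blast
  then have "apollonian_stack p V E T a b c w"
    using stack by unfold_locales
  then show ?case by (blast intro: apollonian_stack.straight_drawing_stack)
qed

text \<open>Through the injection \<open>\<phi>\<close> one network serves every graph that fits
  into it, whatever its labels and with possibly fewer vertices and edges. A segment traversed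
  backwards is the reversed curve, as \<open>plane_drawing\<close> demands for the opposite
  arc.\<close>

lemma planar_subgraph_apollonian:
  fixes \<phi> :: "'b \<Rightarrow> 'a"
  assumes "apollonian V E T" and H: "pair_graph H"
    and \<phi>: "inj_on \<phi> (pverts H)" "\<phi> ` pverts H \<subseteq> V"
    and arcs: "\<And>u v. (u, v) \<in> parcs H \<Longrightarrow> {\<phi> u, \<phi> v} \<in> E"
  shows "planar H"
proof -
  interpret pair_graph H by fact
  obtain p where "straight_drawing p V E T"
    using apollonian_straight_drawing[OF assms(1)] by blast
  note D = straight_drawingD[OF this]
  define c where "c e = linepath (p (\<phi> (fst e))) (p (\<phi> (snd e)))" for e :: "'b \<times> 'b"
  have inj: "inj_on (p \<circ> \<phi>) (pverts H)"
    by (rule comp_inj_on[OF \<phi>(1) inj_on_subset[OF D(1) \<phi>(2)]])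
  have img: "path_image (c (u, v)) = convex hull (p ` {\<phi> u, \<phi> v})" for u v
    by (simp add: c_def segment_convex_hull)
  have drawn: "Path_Connected.arc (c (u, v)) \<and> pathstart (c (u, v)) = (p \<circ> \<phi>) u \<and>
      pathfinish (c (u, v)) = (p \<circ> \<phi>) v \<and> c (v, u) = reversepath (c (u, v)) \<and>
      (path_image (c (u, v)) - {(p \<circ> \<phi>) u, (p \<circ> \<phi>) v}) \<inter> (p \<circ> \<phi>) ` pverts H = {}"
    if uv: "(u, v) \<in> parcs H" for u v
  proof (intro conjI)
    have in_V: "u \<in> pverts H" "v \<in> pverts H" "u \<noteq> v"
      using in_arcsD1[OF uv] in_arcsD2[OF uv] pair_no_loops[OF uv] by simp_all
    have "(p \<circ> \<phi>) u \<noteq> (p \<circ> \<phi>) v"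
      using inj_onD[OF inj _ in_V(1,2)] in_V(3) by blast
    then show "Path_Connected.arc (c (u, v))"
      by (simp add: c_def arc_linepath)
    show "pathstart (c (u, v)) = (p \<circ> \<phi>) u" "pathfinish (c (u, v)) = (p \<circ> \<phi>) v"
      by (simp_all add: c_def)
    show "c (v, u) = reversepath (c (u, v))"
      by (simp add: c_def reversepath_linepath)
    have "(p \<circ> \<phi>) ` pverts H \<subseteq> p ` V" using \<phi>(2) by auto
    then have "relint_segment (p ` {\<phi> u, \<phi> v}) \<inter> (p \<circ> \<phi>) ` pverts H = {}"
      using D(3)[OF arcs[OF uv]] by blast
    then show "(path_image (c (u, v)) - {(p \<circ> \<phi>) u, (p \<circ> \<phi>) v}) \<inter> (p \<circ> \<phi>) ` pverts H = {}"
      unfolding img by simp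
  qed
  have apart: "(path_image (c (u, v)) - {(p \<circ> \<phi>) u, (p \<circ> \<phi>) v}) \<inter> path_image (c (x, y)) = {}"
    if uv: "(u, v) \<in> parcs H" and xy: "(x, y) \<in> parcs H" and ne: "{x, y} \<noteq> {u, v}" for u v x y
  proof -
    have "{u, v} \<subseteq> pverts H" "{x, y} \<subseteq> pverts H"
      using in_arcsD1[OF uv] in_arcsD2[OF uv] in_arcsD1[OF xy] in_arcsD2[OF xy] by simp_all
    then have "\<phi> ` {u, v} \<noteq> \<phi> ` {x, y}"
      using inj_on_image_eq_iff[OF \<phi>(1)] ne by metis
    then have "{\<phi> u, \<phi> v} \<noteq> {\<phi> x, \<phi> y}" by simp
    from D(4)[OF arcs[OF uv] arcs[OF xy] this]
    show ?thesis unfolding img by simp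
  qed
  have "plane_drawing H (p \<circ> \<phi>) c"
    unfolding plane_drawing_def using inj drawn apart by blast
  then show ?thesis unfolding planar_def using H by blast
qed

section \<open>The planar layers\<close>

lemma apollonian_face_subset: "apollonian V E T \<Longrightarrow> F \<in> T \<Longrightarrow> F \<subseteq> V"
  by (induction arbitrary: F rule: apollonian.induct) blast+

lemma remaining_face: "T - {F0} \<subseteq> T' \<Longrightarrow> F \<in> T \<Longrightarrow> F \<noteq> F0 \<Longrightarrow> F \<in> T'"
  by blast

text \<open>Only inclusions are kept: additional edges do no harm in a supergraph of a layer, and of
  the faces only those still to be subdivided have to be followed.\<close>

lemma apollonian_stackE:
  assumes "apollonian V E T" "{a, b, q} \<in> T" "w \<notin> V"
  obtains E' T' where "apollonian (insert w V) E' T'"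
    "E \<subseteq> E'" "{w, a} \<in> E'" "{w, b} \<in> E'" "{w, q} \<in> E'"
    "T - {{a, b, q}} \<subseteq> T'"
    "{w, a, b} \<in> T'" "{w, a, q} \<in> T'" "{w, b, q} \<in> T'"
  by (rule that[OF apollonian.stack[OF assms]]) auto

text \<open>The next vertex goes into the triangle formed by \<open>ab\<close> and the previous
  vertex, which is why \<open>q\<close> varies in the induction.\<close>

lemma apollonian_bundle:
  assumes "finite S" "apollonian V E T" "{a, b, q} \<in> T" "S \<inter> V = {}"
  shows "\<exists>E' T'. apollonian (S \<union> V) E' T' \<and> E \<subseteq> E' \<and> T - {{a, b, q}} \<subseteq> T' \<and>
    (\<forall>w\<in>S. {w, a} \<in> E' \<and> {w, b} \<in> E')"
  using assms
proof (induction S arbitrary: V E T q rule: finite_induct)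
  case empty
  then show ?case by auto
next
  case (insert w S)
  have w: "w \<notin> V" using insert.prems by blast
  obtain E1 T1 where 1: "apollonian (insert w V) E1 T1"
    "E \<subseteq> E1" "{w, a} \<in> E1" "{w, b} \<in> E1" "{w, q} \<in> E1"
    "T - {{a, b, q}} \<subseteq> T1"
    "{w, a, b} \<in> T1" "{w, a, q} \<in> T1" "{w, b, q} \<in> T1"
    by (rule apollonian_stackE[OF insert.prems(1,2) w])
  have "{a, b, w} = {w, a, b}" by blast
  then have F: "{a, b, w} \<in> T1" using 1(7) by simp
  have "S \<inter> insert w V = {}" using insert.hyps insert.prems by blast
  from insert.IH[OF 1(1) F this] obtain E2 T2 where
    2: "apollonian (S \<union> insert w V) E2 T2" "E1 \<subseteq> E2" "T1 - {{a, b, w}} \<subseteq> T2"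
      "\<forall>w\<in>S. {w, a} \<in> E2 \<and> {w, b} \<in> E2"
    by blast
  \<comment> \<open>The triangle given up to the rest of the bundle has the new corner
    \<open>w\<close>, so it is none of the faces in \<open>T\<close>.\<close>
  have "{a, b, w} \<notin> T" using apollonian_face_subset[OF insert.prems(1), of "{a, b, w}"] w by auto
  then have "F \<in> T2" if "F \<in> T - {{a, b, q}}" for F
    using that remaining_face[OF 1(6), of F] 2(3) by auto
  then have "T - {{a, b, q}} \<subseteq> T2" by (rule subsetI)
  moreover have "S \<union> insert w V = insert w S \<union> V" by blast
  moreover have "E \<subseteq> E2" using 1(2) 2(2) by (rule subset_trans)
  moreover have "\<forall>w\<in>insert w S. {w, a} \<in> E2 \<and> {w, b} \<in> E2"
    using subsetD[OF 2(2) 1(3)] subsetD[OF 2(2) 1(4)] 2(4) by simp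
  ultimately show ?case using 2(1) by metis
qed

text \<open>Stacking \<open>f\<close> first joins it to \<open>q\<close> as well; later
  \<open>q\<close> is the apex. \<open>f\<close> may be missing from \<open>S\<close>, since for the
  last group the indices \<open>4 * s + 6\<close> and \<open>4 * s + 7\<close> are out of
  range.\<close>

lemma apollonian_bundle_first:
  assumes "finite S" "apollonian V E T" "{a, b, q} \<in> T" "S \<inter> V = {}"
  obtains E' T' where "apollonian (S \<union> V) E' T'" "E \<subseteq> E'" "T - {{a, b, q}} \<subseteq> T'"
    "\<And>w. w \<in> S \<Longrightarrow> {w, a} \<in> E'" "\<And>w. w \<in> S \<Longrightarrow> {w, b} \<in> E'" "f \<in> S \<Longrightarrow> {f, q} \<in> E'"
proof (cases "f \<in> S")
  case False
  then show thesis using apollonian_bundle[OF assms] that by blast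
next
  case True
  have f: "f \<notin> V" using True assms(4) by blast
  obtain E1 T1 where 1: "apollonian (insert f V) E1 T1"
    "E \<subseteq> E1" "{f, a} \<in> E1" "{f, b} \<in> E1" "{f, q} \<in> E1"
    "T - {{a, b, q}} \<subseteq> T1"
    "{f, a, b} \<in> T1" "{f, a, q} \<in> T1" "{f, b, q} \<in> T1"
    by (rule apollonian_stackE[OF assms(2,3) f])
  have "{a, b, f} = {f, a, b}" by blast
  then have F: "{a, b, f} \<in> T1" using 1(7) by simp
  have "finite (S - {f})" "(S - {f}) \<inter> insert f V = {}" using assms(1,4) by blast+
  from apollonian_bundle[OF this(1) 1(1) F this(2)] obtain E2 T2 where
    2: "apollonian (S - {f} \<union> insert f V) E2 T2" "E1 \<subseteq> E2" "T1 - {{a, b, f}} \<subseteq> T2"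
      "\<forall>w\<in>S - {f}. {w, a} \<in> E2 \<and> {w, b} \<in> E2"
    by blast
  have "{a, b, f} \<notin> T" using apollonian_face_subset[OF assms(2), of "{a, b, f}"] f by auto
  then have "F \<in> T2" if "F \<in> T - {{a, b, q}}" for F
    using that remaining_face[OF 1(6), of F] 2(3) by auto
  then have t: "T - {{a, b, q}} \<subseteq> T2" by (rule subsetI)
  have v: "S - {f} \<union> insert f V = S \<union> V" using True by blast
  have e: "E \<subseteq> E2" using 1(2) 2(2) by (rule subset_trans)
  have ab: "{w, a} \<in> E2 \<and> {w, b} \<in> E2" if "w \<in> S" for w
    using that subsetD[OF 2(2) 1(3)] subsetD[OF 2(2) 1(4)] 2(4) by (cases "w = f") simp_all
  show thesis
    by (rule that[OF 2(1)[unfolded v] e t]) (use ab subsetD[OF 2(2) 1(5)] in simp_all)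
qed

text \<open>
  The pieces \<open>f1 - g1 - f2 - g2\<close> are lined up between the terminals \<open>a\<close> (adjacent to the \<open>g\<close>s)
  and \<open>b\<close> (adjacent to the \<open>f\<close>s); the triangle \<open>abq\<close> is where the next piece goes.
\<close>

lemma apollonian_chain:
  fixes f1 f2 g1 g2 :: "nat \<Rightarrow> 'a"
  assumes V: "apollonian V E T" "{a, b, x} \<in> T"
    and new: "\<And>s. s < m \<Longrightarrow> distinct [f1 s, f2 s, g1 s, g2 s]"
      "\<And>s. s < m \<Longrightarrow> {f1 s, f2 s, g1 s, g2 s} \<inter> V = {}"
      "\<And>s t. s < t \<Longrightarrow> t < m \<Longrightarrow> {f1 s, f2 s, g1 s, g2 s} \<inter> {f1 t, f2 t, g1 t, g2 t} = {}"
  shows "\<exists>E' T' q. apollonian ((\<Union>s<m. {f1 s, f2 s, g1 s, g2 s}) \<union> V) E' T' \<and>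
    E \<subseteq> E' \<and> T - {{a, b, x}} \<subseteq> T' \<and> {a, b, q} \<in> T' \<and>
    (m = 0 \<longrightarrow> q = x) \<and> {a, b, q} \<notin> T - {{a, b, x}} \<and>
    (\<forall>s<m. {{g1 s, a}, {g2 s, a}, {f1 s, b}, {f2 s, b}, {f1 s, g1 s}, {f2 s, g1 s}, {f2 s, g2 s}} \<subseteq> E') \<and>
    (0 < m \<longrightarrow> {f2 0, x} \<in> E')" (is "?P m")
  using new
proof (induction m)
  case 0
  show ?case using V by (intro exI[of _ E] exI[of _ T] exI[of _ x]) simp
next
  case (Suc m)
  let ?N = "\<lambda>m. \<Union>s<m. {f1 s, f2 s, g1 s, g2 s}"
  have prem: "\<And>s. s < m \<Longrightarrow> distinct [f1 s, f2 s, g1 s, g2 s]"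
    "\<And>s. s < m \<Longrightarrow> {f1 s, f2 s, g1 s, g2 s} \<inter> V = {}"
    "\<And>s t. s < t \<Longrightarrow> t < m \<Longrightarrow> {f1 s, f2 s, g1 s, g2 s} \<inter> {f1 t, f2 t, g1 t, g2 t} = {}"
    by (rule Suc.prems; simp)+
  have "?P m" by (rule Suc.IH[OF prem])
  then obtain E0 T0 q where
    0: "apollonian (?N m \<union> V) E0 T0" "E \<subseteq> E0" "T - {{a, b, x}} \<subseteq> T0" "{a, b, q} \<in> T0"
      "m = 0 \<longrightarrow> q = x" "{a, b, q} \<notin> T - {{a, b, x}}"
      "\<forall>s<m. {{g1 s, a}, {g2 s, a}, {f1 s, b}, {f2 s, b}, {f1 s, g1 s}, {f2 s, g1 s}, {f2 s, g2 s}} \<subseteq> E0"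
      "0 < m \<longrightarrow> {f2 0, x} \<in> E0"
    by (elim exE conjE) (rule that)
  let ?W = "?N m \<union> V"
  have d: "distinct [f1 m, f2 m, g1 m, g2 m]" by (rule Suc.prems(1)) simp
  have nV: "{f1 m, f2 m, g1 m, g2 m} \<inter> V = {}" by (rule Suc.prems(2)) simp
  have "{f1 s, f2 s, g1 s, g2 s} \<inter> {f1 m, f2 m, g1 m, g2 m} = {}" if "s < m" for s
    using that by (intro Suc.prems(3)) simp_all
  then have "{f1 m, f2 m, g1 m, g2 m} \<inter> ?N m = {}" by blast
  with nV have nW: "f1 m \<notin> ?W" "f2 m \<notin> ?W" "g1 m \<notin> ?W" "g2 m \<notin> ?W" by blast+
  have FT: "F \<subseteq> V" if "F \<in> T" for F by (rule apollonian_face_subset[OF V(1) that])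
  have FW: "F \<subseteq> ?W" if "F \<in> T0" for F by (rule apollonian_face_subset[OF 0(1) that])
  have ab: "a \<in> ?W" "b \<in> ?W" using FW[OF 0(4)] by blast+
  \<comment> \<open>\<open>f2\<close>, \<open>g1\<close>, \<open>f1\<close> are stacked in turn into
    the current triangle on \<open>ab\<close>, which makes each adjacent to its predecessor;
    \<open>g2\<close> goes aside into \<open>g1 f2 a\<close>. The triangle \<open>a b f1\<close> is
    left for the next piece.\<close>
  obtain E1 T1 where 1: "apollonian (insert (f2 m) ?W) E1 T1"
    "E0 \<subseteq> E1" "{f2 m, a} \<in> E1" "{f2 m, b} \<in> E1" "{f2 m, q} \<in> E1"
    "T0 - {{a, b, q}} \<subseteq> T1"
    "{f2 m, a, b} \<in> T1" "{f2 m, a, q} \<in> T1" "{f2 m, b, q} \<in> T1"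
    by (rule apollonian_stackE[OF 0(1,4) nW(2)])
  have n1: "g1 m \<notin> insert (f2 m) ?W" using nW(3) d by auto
  obtain E2 T2 where 2: "apollonian (insert (g1 m) (insert (f2 m) ?W)) E2 T2"
    "E1 \<subseteq> E2" "{g1 m, f2 m} \<in> E2" "{g1 m, a} \<in> E2" "{g1 m, b} \<in> E2"
    "T1 - {{f2 m, a, b}} \<subseteq> T2"
    "{g1 m, f2 m, a} \<in> T2" "{g1 m, f2 m, b} \<in> T2" "{g1 m, a, b} \<in> T2"
    by (rule apollonian_stackE[OF 1(1,7) n1])
  have n2: "f1 m \<notin> insert (g1 m) (insert (f2 m) ?W)" using nW(1) d by auto
  obtain E3 T3 where 3: "apollonian (insert (f1 m) (insert (g1 m) (insert (f2 m) ?W))) E3 T3"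
    "E2 \<subseteq> E3" "{f1 m, g1 m} \<in> E3" "{f1 m, a} \<in> E3" "{f1 m, b} \<in> E3"
    "T2 - {{g1 m, a, b}} \<subseteq> T3"
    "{f1 m, g1 m, a} \<in> T3" "{f1 m, g1 m, b} \<in> T3" "{f1 m, a, b} \<in> T3"
    by (rule apollonian_stackE[OF 2(1,9) n2])
  have dist: "f2 m \<noteq> g1 m" "f2 m \<noteq> a" "f2 m \<noteq> b" "f1 m \<noteq> f2 m" "f1 m \<noteq> g1 m" "f1 m \<noteq> a"
    using d ab nW by auto
  have "f2 m \<notin> {g1 m, a, b}" using dist by simp
  then have "{g1 m, f2 m, a} \<noteq> {g1 m, a, b}" by blast
  with 2(7) have F3: "{g1 m, f2 m, a} \<in> T3" by (rule remaining_face[OF 3(6)])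
  have n3: "g2 m \<notin> insert (f1 m) (insert (g1 m) (insert (f2 m) ?W))" using nW(4) d by auto
  obtain E4 T4 where 4: "apollonian (insert (g2 m) (insert (f1 m) (insert (g1 m) (insert (f2 m) ?W)))) E4 T4"
    "E3 \<subseteq> E4" "{g2 m, g1 m} \<in> E4" "{g2 m, f2 m} \<in> E4" "{g2 m, a} \<in> E4"
    "T3 - {{g1 m, f2 m, a}} \<subseteq> T4"
    "{g2 m, g1 m, f2 m} \<in> T4" "{g2 m, g1 m, a} \<in> T4" "{g2 m, f2 m, a} \<in> T4"
    by (rule apollonian_stackE[OF 3(1) F3 n3])
  have "f1 m \<notin> {g1 m, f2 m, a}" using dist by simp
  then have "{f1 m, a, b} \<noteq> {g1 m, f2 m, a}" by blast
  with 3(9) have "{f1 m, a, b} \<in> T4" by (rule remaining_face[OF 4(6)])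
  moreover have "{a, b, f1 m} = {f1 m, a, b}" by blast
  ultimately have F4: "{a, b, f1 m} \<in> T4" by simp
  \<comment> \<open>By \<open>0(6)\<close> the triangle subdivided first is none of the faces to be
    preserved; the triangles subdivided afterwards have a new corner.\<close>
  have keep: "T - {{a, b, x}} \<subseteq> T4"
  proof
    fix F assume F: "F \<in> T - {{a, b, x}}"
    have F0: "F \<in> T0" using 0(3) F by (rule subsetD)
    have "F \<noteq> {a, b, q}" using 0(6) F by metis
    with F0 have F1: "F \<in> T1" by (rule remaining_face[OF 1(6)])
    have nF: "f2 m \<notin> F" "g1 m \<notin> F" using FT[of F] F nW by auto
    have "F \<noteq> {f2 m, a, b}" using nF(1) by blast
    with F1 have F2: "F \<in> T2" by (rule remaining_face[OF 2(6)])
    have "F \<noteq> {g1 m, a, b}" using nF(2) by blast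
    with F2 have F3: "F \<in> T3" by (rule remaining_face[OF 3(6)])
    have "F \<noteq> {g1 m, f2 m, a}" using nF(2) by blast
    with F3 show "F \<in> T4" by (rule remaining_face[OF 4(6)])
  qed
  have E24: "E2 \<subseteq> E4" using 3(2) 4(2) by (rule subset_trans)
  have E14: "E1 \<subseteq> E4" using 2(2) E24 by (rule subset_trans)
  have E04: "E0 \<subseteq> E4" using 1(2) E14 by (rule subset_trans)
  have EE4: "E \<subseteq> E4" using 0(2) E04 by (rule subset_trans)
  have W: "insert (g2 m) (insert (f1 m) (insert (g1 m) (insert (f2 m) ?W))) = ?N (Suc m) \<union> V"
    unfolding lessThan_Suc by auto
  have "{a, b, f1 m} \<notin> T" using FT[of "{a, b, f1 m}"] nW(1) by auto
  then have q: "{a, b, f1 m} \<notin> T - {{a, b, x}}" by simp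
  have "{f2 m, g1 m} = {g1 m, f2 m}" "{f2 m, g2 m} = {g2 m, f2 m}" by blast+
  then have m: "{{g1 m, a}, {g2 m, a}, {f1 m, b}, {f2 m, b}, {f1 m, g1 m}, {f2 m, g1 m}, {f2 m, g2 m}} \<subseteq> E4"
    using subsetD[OF E24 2(3)] subsetD[OF E24 2(4)] subsetD[OF E14 1(4)]
      subsetD[OF 4(2) 3(3)] subsetD[OF 4(2) 3(5)] 4(4,5) by simp
  have edges: "\<forall>s<Suc m. {{g1 s, a}, {g2 s, a}, {f1 s, b}, {f2 s, b}, {f1 s, g1 s}, {f2 s, g1 s}, {f2 s, g2 s}} \<subseteq> E4"
  proof (intro allI impI)
    fix s assume "s < Suc m"
    then consider "s = m" | "s < m" by linarith
    then show "{{g1 s, a}, {g2 s, a}, {f1 s, b}, {f2 s, b}, {f1 s, g1 s}, {f2 s, g1 s}, {f2 s, g2 s}} \<subseteq> E4"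
    proof cases
      case 1
      show ?thesis unfolding 1 by (rule m)
    next
      case 2
      show ?thesis by (rule subset_trans[OF 0(7)[rule_format, OF 2] E04])
    qed
  qed
  have first: "{f2 0, x} \<in> E4"
  proof (cases "m = 0")
    case True
    then show ?thesis using subsetD[OF E14 1(5)] 0(5) by simp
  next
    case False
    then show ?thesis using 0(8) E04 by auto
  qed
  show ?case
    using 4(1)[unfolded W] EE4 keep F4 q edges first
    by (intro exI[of _ E4] exI[of _ T4] exI[of _ "f1 m"]) simp
qed

section \<open>The networks of the inner layers and of the last layer\<close>

datatype vertex = Apex | Lft nat | Rgt nat

text \<open>
  Each of \<open>u1u2\<close>, \<open>u3u4\<close>, \<open>v1v2\<close>, \<open>v3v4\<close> lies on a face of its own, ready to receive a bundle of
  parallel paths of length two. The apex \<open>x\<close> can see \<open>v1v2\<close> and \<open>v3v4\<close>, but not \<open>u2\<close> and \<open>u4\<close>.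
\<close>

lemma apollonian_core:
  assumes "distinct [x, u1, u2, u3, u4, v1, v2, v3, v4]"
  obtains E T where "apollonian {x, u1, u2, u3, u4, v1, v2, v3, v4} E T"
    "{{x, u1}, {x, u3}, {x, v1}, {x, v2}, {x, v3}, {x, v4},
      {u1, v3}, {u1, v4}, {u2, v3}, {u2, v4}, {u3, v1}, {u3, v2}, {u4, v1}, {u4, v2},
      {u1, v2}, {u3, v4}} \<subseteq> E"
    "{{v3, v4, x}, {u1, u2, v3}, {v1, v2, x}, {u3, u4, v1}} \<subseteq> T"
proof -
  \<comment> \<open>With the reversed list the simplifier has every inequality in both
    directions.\<close>
  have "distinct (rev [x, u1, u2, u3, u4, v1, v2, v3, v4])"
    using assms by (simp only: distinct_rev)
  note ds = assms this
  \<comment> \<open>The other vertices are stacked in the order \<open>x\<close>, \<open>v2\<close>,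
    \<open>v3\<close>, \<open>u2\<close>, \<open>v1\<close>, \<open>u4\<close>. The edges
    \<open>u1v2\<close> and \<open>u3v4\<close> are by-products that will relieve the last
    layer.\<close>
  have "distinct [u1, u3, v4]" using ds by simp
  from apollonian.triangle[OF this]
  have 1: "apollonian {u1, u3, v4} {{u1, u3}, {u1, v4}, {u3, v4}} {{u1, u3, v4}}" .
  obtain E2 T2 where 2: "apollonian ({x, u1, u3, v4}) E2 T2"
    "{{u1, u3}, {u1, v4}, {u3, v4}} \<subseteq> E2" "{x, u1} \<in> E2" "{x, u3} \<in> E2" "{x, v4} \<in> E2"
    "{{u1, u3, v4}} - {{u1, u3, v4}} \<subseteq> T2"
    "{x, u1, u3} \<in> T2" "{x, u1, v4} \<in> T2" "{x, u3, v4} \<in> T2"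
    by (rule apollonian_stackE[OF 1, of u1 u3 v4 x]) (use ds in simp_all)
  obtain E3 T3 where 3: "apollonian ({v2, x, u1, u3, v4}) E3 T3"
    "E2 \<subseteq> E3" "{v2, x} \<in> E3" "{v2, u1} \<in> E3" "{v2, u3} \<in> E3"
    "T2 - {{x, u1, u3}} \<subseteq> T3"
    "{v2, x, u1} \<in> T3" "{v2, x, u3} \<in> T3" "{v2, u1, u3} \<in> T3"
    by (rule apollonian_stackE[OF 2(1,7), of v2]) (use ds in simp_all)
  have "v4 \<notin> {x, u1, u3}" using ds by simp
  then have "{x, u1, v4} \<noteq> {x, u1, u3}" by blast
  with 2(8) have F3: "{x, u1, v4} \<in> T3" by (rule remaining_face[OF 3(6)])
  obtain E4 T4 where 4: "apollonian ({v3, v2, x, u1, u3, v4}) E4 T4"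
    "E3 \<subseteq> E4" "{v3, x} \<in> E4" "{v3, u1} \<in> E4" "{v3, v4} \<in> E4"
    "T3 - {{x, u1, v4}} \<subseteq> T4"
    "{v3, x, u1} \<in> T4" "{v3, x, v4} \<in> T4" "{v3, u1, v4} \<in> T4"
    by (rule apollonian_stackE[OF 3(1) F3, of v3]) (use ds in simp_all)
  obtain E5 T5 where 5: "apollonian ({u2, v3, v2, x, u1, u3, v4}) E5 T5"
    "E4 \<subseteq> E5" "{u2, v3} \<in> E5" "{u2, u1} \<in> E5" "{u2, v4} \<in> E5"
    "T4 - {{v3, u1, v4}} \<subseteq> T5"
    "{u2, v3, u1} \<in> T5" "{u2, v3, v4} \<in> T5" "{u2, u1, v4} \<in> T5"
    by (rule apollonian_stackE[OF 4(1,9), of u2]) (use ds in simp_all)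
  have "v2 \<notin> {x, u1, v4}" "v2 \<notin> {v3, u1, v4}" using ds by simp_all
  then have "{v2, x, u3} \<noteq> {x, u1, v4}" "{v2, x, u3} \<noteq> {v3, u1, v4}" by blast+
  then have F5: "{v2, x, u3} \<in> T5" using remaining_face[OF 5(6) remaining_face[OF 4(6) 3(8)]] by simp
  obtain E6 T6 where 6: "apollonian ({v1, u2, v3, v2, x, u1, u3, v4}) E6 T6"
    "E5 \<subseteq> E6" "{v1, v2} \<in> E6" "{v1, x} \<in> E6" "{v1, u3} \<in> E6"
    "T5 - {{v2, x, u3}} \<subseteq> T6"
    "{v1, v2, x} \<in> T6" "{v1, v2, u3} \<in> T6" "{v1, x, u3} \<in> T6"
    by (rule apollonian_stackE[OF 5(1) F5, of v1]) (use ds in simp_all)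
  obtain E7 T7 where 7: "apollonian ({u4, v1, u2, v3, v2, x, u1, u3, v4}) E7 T7"
    "E6 \<subseteq> E7" "{u4, v1} \<in> E7" "{u4, v2} \<in> E7" "{u4, u3} \<in> E7"
    "T6 - {{v1, v2, u3}} \<subseteq> T7"
    "{u4, v1, v2} \<in> T7" "{u4, v1, u3} \<in> T7" "{u4, v2, u3} \<in> T7"
    by (rule apollonian_stackE[OF 6(1,8), of u4]) (use ds in simp_all)
  have E5: "E5 \<subseteq> E7" using 6(2) 7(2) by (rule subset_trans)
  have E4: "E4 \<subseteq> E7" using 5(2) E5 by (rule subset_trans)
  have E3: "E3 \<subseteq> E7" using 4(2) E4 by (rule subset_trans)
  have E2: "E2 \<subseteq> E7" using 3(2) E3 by (rule subset_trans)
  have e: "{u1, v4} \<in> E7" "{u3, v4} \<in> E7"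
    using 2(2) E2 by auto
  note e = e 2(3-5)[THEN subsetD[OF E2]] 3(3-5)[THEN subsetD[OF E3]] 4(3,4)[THEN subsetD[OF E4]]
    5(3,5)[THEN subsetD[OF E5]] 6(4,5)[THEN subsetD[OF 7(2)]] 7(3,4)
  have "v4 \<notin> {v2, x, u3}" "v4 \<notin> {v1, v2, u3}" "x \<notin> {v3, u1, v4}" "u2 \<notin> {v2, x, u3}"
    "u2 \<notin> {v1, v2, u3}" "x \<notin> {v1, v2, u3}"
    using ds by simp_all
  then have ne: "{v3, x, v4} \<noteq> {v3, u1, v4}" "{v3, x, v4} \<noteq> {v2, x, u3}" "{v3, x, v4} \<noteq> {v1, v2, u3}"
    "{u2, v3, u1} \<noteq> {v2, x, u3}" "{u2, v3, u1} \<noteq> {v1, v2, u3}" "{v1, v2, x} \<noteq> {v1, v2, u3}"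
    by blast+
  have t: "{v3, x, v4} \<in> T7"
    by (rule remaining_face[OF 7(6) remaining_face[OF 6(6) remaining_face[OF 5(6) 4(8) ne(1)] ne(2)] ne(3)])
  note t = t remaining_face[OF 7(6) remaining_face[OF 6(6) 5(7) ne(4)] ne(5)]
    remaining_face[OF 7(6) 6(7) ne(6)] 7(8)
  have "{u4, v1, u2, v3, v2, x, u1, u3, v4} = {x, u1, u2, u3, u4, v1, v2, v3, v4}" by blast
  with 7(1) have G: "apollonian {x, u1, u2, u3, u4, v1, v2, v3, v4} E7 T7" by simp
  show thesis
    by (rule that[OF G]) (use e t in \<open>simp_all add: insert_commute\<close>)
qed

text \<open>
  Group \<open>s < p\<close> consists of the indices \<open>4s, \<dots>, 4s + 3\<close> of both parts. The indices \<open>4p\<close> and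
  \<open>4p + 1\<close> belong to no group: they are outside vertices of every inner layer and the terminals of
  the last one. In \<open>apollonian_core\<close>, \<open>u1, u2, u3, u4\<close> have indices \<open>4s, 4s + 2, 4s + 1, 4s + 3\<close>,
  and likewise for the \<open>v\<close>s, so that bundles are indexed by parity.
\<close>

definition layer_vertices :: "nat \<Rightarrow> vertex set" where
  "layer_vertices p = insert Apex (Lft ` {..<4 * p + 2} \<union> Rgt ` {..<4 * p + 2})"

text \<open>An edge between different groups belongs to the layer of its left end if the parities
  agree, and to that of its right end otherwise. The last two disjuncts are the edges
  \<open>u1v2\<close> and \<open>u3v4\<close> of the core.\<close>

definition inner_edge :: "nat \<Rightarrow> nat \<Rightarrow> nat \<Rightarrow> bool" where
  "inner_edge s i j \<longleftrightarrow>
     i div 4 = s \<and> j div 4 \<noteq> s \<and> (even i \<longleftrightarrow> even j) \<or>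
     j div 4 = s \<and> (even i \<longleftrightarrow> odd j) \<or>
     i = 4 * s \<and> j = 4 * s + 2 \<or> i = 4 * s + 1 \<and> j = 4 * s + 3"

text \<open>Inside a group the edges with ends of equal parity form two 4-cycles. Each has one edge
  with \<open>j = i + 2\<close>, which an inner layer already draws; what remains is a path of three
  edges, the piece \<open>f1 - g1 - f2 - g2\<close> of a chain.\<close>

definition last_edge :: "nat \<Rightarrow> nat \<Rightarrow> nat \<Rightarrow> bool" where
  "last_edge p i j \<longleftrightarrow>
     4 * p \<le> i \<and> (4 * p \<le> j \<or> (even i \<longleftrightarrow> even j)) \<or>
     i < 4 * p \<and> 4 * p \<le> j \<and> (even i \<longleftrightarrow> odd j) \<or>
     i < 4 * p \<and> j < 4 * p \<and> i div 4 = j div 4 \<and> (even i \<longleftrightarrow> even j) \<and> j \<noteq> i + 2"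

lemma group_cases:
  fixes i s :: nat
  assumes "i div 4 = s"
  obtains "i = 4 * s" | "i = 4 * s + 1" | "i = 4 * s + 2" | "i = 4 * s + 3"
  using assms by linarith

lemma layers_cover:
  assumes "i < 4 * p + 2" "j < 4 * p + 2"
  shows "last_edge p i j \<or> (\<exists>s<p. inner_edge s i j)"
proof (cases "4 * p \<le> i \<or> 4 * p \<le> j")
  case True
  show ?thesis
  proof (cases "last_edge p i j")
    case False
    then consider "i < 4 * p" "even i \<longleftrightarrow> even j" "4 * p \<le> j" | "j < 4 * p" "even i \<longleftrightarrow> odd j"
      using True unfolding last_edge_def by linarith
    then show ?thesis
    proof cases
      case 1
      then have "i div 4 < p" "p \<le> j div 4" by linarith+
      then have "i div 4 < p \<and> inner_edge (i div 4) i j"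
        unfolding inner_edge_def using 1(2) by simp
      then show ?thesis by blast
    next
      case 2
      then have "j div 4 < p" by linarith
      then have "j div 4 < p \<and> inner_edge (j div 4) i j"
        unfolding inner_edge_def using 2(2) by simp
      then show ?thesis by blast
    qed
  qed simp
next
  case False
  then have ij: "i < 4 * p" "j < 4 * p" by auto
  then have p: "i div 4 < p" "j div 4 < p" by linarith+
  show ?thesis
  proof (cases "even i \<longleftrightarrow> even j")
    case False
    then have "inner_edge (j div 4) i j" unfolding inner_edge_def by blast
    then show ?thesis using p by blast
  next
    case same: True
    show ?thesis
    proof (cases "i div 4 = j div 4")
      case False
      then have "inner_edge (i div 4) i j" unfolding inner_edge_def using same by metis
      then show ?thesis using p by blast
    next
      case True
      show ?thesis
      proof (cases "j = i + 2")
        case False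
        then show ?thesis unfolding last_edge_def using ij same True by blast
      next
        case j: True
        have "i = 4 * (i div 4) \<or> i = 4 * (i div 4) + 1" using True j by linarith
        then have "inner_edge (i div 4) i j" unfolding inner_edge_def using j by linarith
        then show ?thesis using p by blast
      qed
    qed
  qed
qed

text \<open>
  The apex misses \<open>4s + 2\<close> and \<open>4s + 3\<close> on the left; instead it sees the corresponding vertices
  \<open>4s + 6\<close> and \<open>4s + 7\<close> of the next group, which are placed first in their bundles.
\<close>

lemma inner_layer:
  assumes s: "s < p"
  shows "\<exists>W E T. apollonian W E T \<and> layer_vertices p \<subseteq> W \<and>
    (\<forall>i<4 * p + 2. \<forall>j<4 * p + 2. inner_edge s i j \<longrightarrow> {Lft i, Rgt j} \<in> E) \<and>
    (\<forall>i<4 * p + 2. i \<in> {4 * s, 4 * s + 1, 4 * s + 6, 4 * s + 7} \<longrightarrow> {Apex, Lft i} \<in> E) \<and>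
    (\<forall>j. j div 4 = s \<longrightarrow> {Apex, Rgt j} \<in> E)"
proof -
  let ?u1 = "Lft (4 * s)" and ?u2 = "Lft (4 * s + 2)" and ?u3 = "Lft (4 * s + 1)" and ?u4 = "Lft (4 * s + 3)"
  let ?v1 = "Rgt (4 * s)" and ?v2 = "Rgt (4 * s + 2)" and ?v3 = "Rgt (4 * s + 1)" and ?v4 = "Rgt (4 * s + 3)"
  let ?C = "{Apex, ?u1, ?u2, ?u3, ?u4, ?v1, ?v2, ?v3, ?v4}"
  \<comment> \<open>\<open>True\<close> selects the even and \<open>False\<close> the odd indices
    outside the group.\<close>
  define I where "I = (\<lambda>b::bool. {i. i < 4 * p + 2 \<and> (even i \<longleftrightarrow> b) \<and> i div 4 \<noteq> s})"
  have fin: "finite (I b)" for b by (simp add: I_def)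
  have out: "4 * s \<notin> I b" "4 * s + 1 \<notin> I b" "4 * s + 2 \<notin> I b" "4 * s + 3 \<notin> I b" for b
  proof -
    have "4 * s div 4 = s" "(4 * s + 1) div 4 = s" "(4 * s + 2) div 4 = s" "(4 * s + 3) div 4 = s"
      by linarith+
    then show "4 * s \<notin> I b" "4 * s + 1 \<notin> I b" "4 * s + 2 \<notin> I b" "4 * s + 3 \<notin> I b"
      unfolding I_def mem_Collect_eq by blast+
  qed
  have par: "I True \<inter> I False = {}" by (auto simp: I_def)
  have "distinct [Apex, ?u1, ?u2, ?u3, ?u4, ?v1, ?v2, ?v3, ?v4]" by simp
  then obtain E0 T0 where 0: "apollonian ?C E0 T0"
    "{{Apex, ?u1}, {Apex, ?u3}, {Apex, ?v1}, {Apex, ?v2}, {Apex, ?v3}, {Apex, ?v4},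
      {?u1, ?v3}, {?u1, ?v4}, {?u2, ?v3}, {?u2, ?v4}, {?u3, ?v1}, {?u3, ?v2}, {?u4, ?v1}, {?u4, ?v2},
      {?u1, ?v2}, {?u3, ?v4}} \<subseteq> E0"
    "{{?v3, ?v4, Apex}, {?u1, ?u2, ?v3}, {?v1, ?v2, Apex}, {?u3, ?u4, ?v1}} \<subseteq> T0"
    by (rule apollonian_core)
  have F0: "{?v3, ?v4, Apex} \<in> T0" "{?u1, ?u2, ?v3} \<in> T0" "{?v1, ?v2, Apex} \<in> T0" "{?u3, ?u4, ?v1} \<in> T0"
    using 0(3) by simp_all
  \<comment> \<open>Outside vertices on the left become middles over the \<open>v\<close>s of the
    other parity, those on the right over the \<open>u\<close>s of the same parity, as
    \<open>inner_edge\<close> prescribes.\<close>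
  let ?S1 = "Lft ` I True" and ?S2 = "Rgt ` I True" and ?S3 = "Lft ` I False" and ?S4 = "Rgt ` I False"
  have d1: "?S1 \<inter> ?C = {}" and d2: "?S2 \<inter> (?S1 \<union> ?C) = {}"
    and d3: "?S3 \<inter> (?S2 \<union> (?S1 \<union> ?C)) = {}" and d4: "?S4 \<inter> (?S3 \<union> (?S2 \<union> (?S1 \<union> ?C))) = {}"
    using out par by auto
  obtain E1 T1 where 1: "apollonian (?S1 \<union> ?C) E1 T1" "E0 \<subseteq> E1" "T0 - {{?v3, ?v4, Apex}} \<subseteq> T1"
    "\<And>w. w \<in> ?S1 \<Longrightarrow> {w, ?v3} \<in> E1" "\<And>w. w \<in> ?S1 \<Longrightarrow> {w, ?v4} \<in> E1"
    "Lft (4 * s + 6) \<in> ?S1 \<Longrightarrow> {Lft (4 * s + 6), Apex} \<in> E1"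
    using apollonian_bundle_first[OF finite_imageI[OF fin] 0(1) F0(1) d1] by metis
  have "?u1 \<notin> {?v3, ?v4, Apex}" "?v1 \<notin> {?v3, ?v4, Apex}" "?u3 \<notin> {?v3, ?v4, Apex}" by simp_all
  then have "{?u1, ?u2, ?v3} \<noteq> {?v3, ?v4, Apex}" "{?v1, ?v2, Apex} \<noteq> {?v3, ?v4, Apex}"
    "{?u3, ?u4, ?v1} \<noteq> {?v3, ?v4, Apex}" by blast+
  then have F1: "{?u1, ?u2, ?v3} \<in> T1" "{?v1, ?v2, Apex} \<in> T1" "{?u3, ?u4, ?v1} \<in> T1"
    using F0 remaining_face[OF 1(3)] by simp_all
  obtain E2 T2 where 2: "apollonian (?S2 \<union> (?S1 \<union> ?C)) E2 T2" "E1 \<subseteq> E2"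
    "T1 - {{?u1, ?u2, ?v3}} \<subseteq> T2"
    "\<And>w. w \<in> ?S2 \<Longrightarrow> {w, ?u1} \<in> E2" "\<And>w. w \<in> ?S2 \<Longrightarrow> {w, ?u2} \<in> E2"
    using apollonian_bundle_first[OF finite_imageI[OF fin] 1(1) F1(1) d2] by metis
  have "?v1 \<notin> {?u1, ?u2, ?v3}" "?u3 \<notin> {?u1, ?u2, ?v3}" by simp_all
  then have "{?v1, ?v2, Apex} \<noteq> {?u1, ?u2, ?v3}" "{?u3, ?u4, ?v1} \<noteq> {?u1, ?u2, ?v3}" by blast+
  then have F2: "{?v1, ?v2, Apex} \<in> T2" "{?u3, ?u4, ?v1} \<in> T2"
    using F1 remaining_face[OF 2(3)] by simp_all
  obtain E3 T3 where 3: "apollonian (?S3 \<union> (?S2 \<union> (?S1 \<union> ?C))) E3 T3" "E2 \<subseteq> E3"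
    "T2 - {{?v1, ?v2, Apex}} \<subseteq> T3"
    "\<And>w. w \<in> ?S3 \<Longrightarrow> {w, ?v1} \<in> E3" "\<And>w. w \<in> ?S3 \<Longrightarrow> {w, ?v2} \<in> E3"
    "Lft (4 * s + 7) \<in> ?S3 \<Longrightarrow> {Lft (4 * s + 7), Apex} \<in> E3"
    using apollonian_bundle_first[OF finite_imageI[OF fin] 2(1) F2(1) d3] by metis
  have "?u3 \<notin> {?v1, ?v2, Apex}" by simp
  then have "{?u3, ?u4, ?v1} \<noteq> {?v1, ?v2, Apex}" by blast
  then have F3: "{?u3, ?u4, ?v1} \<in> T3"
    using F2 remaining_face[OF 3(3)] by simp
  obtain E T where 4: "apollonian (?S4 \<union> (?S3 \<union> (?S2 \<union> (?S1 \<union> ?C)))) E T" "E3 \<subseteq> E"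
    "\<And>w. w \<in> ?S4 \<Longrightarrow> {w, ?u3} \<in> E" "\<And>w. w \<in> ?S4 \<Longrightarrow> {w, ?u4} \<in> E"
    using apollonian_bundle_first[OF finite_imageI[OF fin] 3(1) F3 d4] by metis
  have E2: "E2 \<subseteq> E" using 3(2) 4(2) by (rule subset_trans)
  have E1: "E1 \<subseteq> E" using 2(2) E2 by (rule subset_trans)
  have E0: "E0 \<subseteq> E" using 1(2) E1 by (rule subset_trans)
  have core: "{Apex, ?u1} \<in> E" "{Apex, ?u3} \<in> E" "{Apex, ?v1} \<in> E" "{Apex, ?v2} \<in> E"
      "{Apex, ?v3} \<in> E" "{Apex, ?v4} \<in> E" "{?u1, ?v3} \<in> E" "{?u1, ?v4} \<in> E" "{?u2, ?v3} \<in> E"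
      "{?u2, ?v4} \<in> E" "{?u3, ?v1} \<in> E" "{?u3, ?v2} \<in> E" "{?u4, ?v1} \<in> E" "{?u4, ?v2} \<in> E"
      "{?u1, ?v2} \<in> E" "{?u3, ?v4} \<in> E"
    using subset_trans[OF 0(2) E0] by simp_all
  have vL: "Lft i \<in> ?S4 \<union> (?S3 \<union> (?S2 \<union> (?S1 \<union> ?C)))" "Rgt i \<in> ?S4 \<union> (?S3 \<union> (?S2 \<union> (?S1 \<union> ?C)))"
    if i: "i < 4 * p + 2" for i
  proof -
    consider "i div 4 = s" | "i \<in> I True" | "i \<in> I False"
      using i unfolding I_def mem_Collect_eq by metis
    then have "Lft i \<in> ?S4 \<union> (?S3 \<union> (?S2 \<union> (?S1 \<union> ?C))) \<and> Rgt i \<in> ?S4 \<union> (?S3 \<union> (?S2 \<union> (?S1 \<union> ?C)))"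
    proof cases
      case 1
      then show ?thesis by (rule group_cases) simp_all
    qed simp_all
    then show "Lft i \<in> ?S4 \<union> (?S3 \<union> (?S2 \<union> (?S1 \<union> ?C)))" "Rgt i \<in> ?S4 \<union> (?S3 \<union> (?S2 \<union> (?S1 \<union> ?C)))"
      by blast+
  qed
  have lay: "layer_vertices p \<subseteq> ?S4 \<union> (?S3 \<union> (?S2 \<union> (?S1 \<union> ?C)))"
    unfolding layer_vertices_def using vL by blast
  have edge: "{Lft i, Rgt j} \<in> E"
    if ij: "i < 4 * p + 2" "j < 4 * p + 2" and e: "inner_edge s i j" for i j
    using e unfolding inner_edge_def
  proof (elim disjE conjE)
    assume a: "i div 4 = s" "j div 4 \<noteq> s" "even i \<longleftrightarrow> even j"
    have j: "j \<in> I (even i)" using a ij by (simp add: I_def)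
    have ev: "{Lft i, Rgt j} = {Rgt j, Lft i}" by blast
    from a(1) show ?thesis
    proof (rule group_cases)
      assume i: "i = 4 * s"
      then have "Rgt j \<in> ?S2" using j by simp
      then have "{Rgt j, Lft i} \<in> E" unfolding i by (rule subsetD[OF E2 2(4)])
      then show ?thesis by (subst ev)
    next
      assume i: "i = 4 * s + 2"
      then have "Rgt j \<in> ?S2" using j by simp
      then have "{Rgt j, Lft i} \<in> E" unfolding i by (rule subsetD[OF E2 2(5)])
      then show ?thesis by (subst ev)
    next
      assume i: "i = 4 * s + 1"
      then have "Rgt j \<in> ?S4" using j by simp
      then have "{Rgt j, Lft i} \<in> E" unfolding i by (rule 4(3))
      then show ?thesis by (subst ev)
    next
      assume i: "i = 4 * s + 3"
      then have "Rgt j \<in> ?S4" using j by simp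
      then have "{Rgt j, Lft i} \<in> E" unfolding i by (rule 4(4))
      then show ?thesis by (subst ev)
    qed
  next
    assume a: "j div 4 = s" "even i \<longleftrightarrow> odd j"
    show ?thesis
    proof (cases "i div 4 = s")
      case True
      show ?thesis
        by (rule group_cases[OF a(1)]; rule group_cases[OF True]) (use a(2) core in simp_all)
    next
      case False
      then have i: "i \<in> I (odd j)" using a ij by (simp add: I_def)
      from a(1) show ?thesis
      proof (rule group_cases)
        assume j: "j = 4 * s"
        then have "Lft i \<in> ?S3" using i by simp
        then show ?thesis unfolding j by (rule subsetD[OF 4(2) 3(4)])
      next
        assume j: "j = 4 * s + 2"
        then have "Lft i \<in> ?S3" using i by simp
        then show ?thesis unfolding j by (rule subsetD[OF 4(2) 3(5)])
      next
        assume j: "j = 4 * s + 1"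
        then have "Lft i \<in> ?S1" using i by simp
        then show ?thesis unfolding j by (rule subsetD[OF E1 1(4)])
      next
        assume j: "j = 4 * s + 3"
        then have "Lft i \<in> ?S1" using i by simp
        then show ?thesis unfolding j by (rule subsetD[OF E1 1(5)])
      qed
    qed
  qed (use core in simp_all)
  have apexL: "{Apex, Lft i} \<in> E" if "i < 4 * p + 2" "i \<in> {4 * s, 4 * s + 1, 4 * s + 6, 4 * s + 7}" for i
  proof -
    from that(2) consider "i = 4 * s" | "i = 4 * s + 1" | "i = 4 * s + 6" | "i = 4 * s + 7" by blast
    then show ?thesis
    proof cases
      case 3
      have "4 * s + 6 \<in> I True" using that(1) unfolding 3 I_def by simp
      then have "{Lft (4 * s + 6), Apex} \<in> E" by (intro subsetD[OF E1 1(6)] imageI)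
      moreover have "{Lft (4 * s + 6), Apex} = {Apex, Lft i}" unfolding 3 by blast
      ultimately show ?thesis by simp
    next
      case 4
      have "4 * s + 7 \<in> I False" using that(1) unfolding 4 I_def by simp
      then have "{Lft (4 * s + 7), Apex} \<in> E" by (intro subsetD[OF \<open>E3 \<subseteq> E\<close> 3(6)] imageI)
      moreover have "{Lft (4 * s + 7), Apex} = {Apex, Lft i}" unfolding 4 by blast
      ultimately show ?thesis by simp
    qed (use core in simp_all)
  qed
  have apexR: "{Apex, Rgt j} \<in> E" if "j div 4 = s" for j
    using that by (rule group_cases) (use core in simp_all)
  show ?thesis
    by (intro exI[of _ "?S4 \<union> (?S3 \<union> (?S2 \<union> (?S1 \<union> ?C)))"] exI[of _ E] exI[of _ T] conjI allI impI;
      (rule 4(1) | rule lay | rule edge; assumption | rule apexL; assumption | rule apexR; assumption))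
qed

text \<open>The even pieces form a chain between \<open>Lft (4 * p)\<close> and
  \<open>Rgt (4 * p + 1)\<close>, the odd ones a chain between \<open>Lft (4 * p + 1)\<close> and
  \<open>Rgt (4 * p)\<close>. Both chains start in triangles whose third corner is the apex, so the
  apex also sees the first \<open>f2\<close> of each: \<open>Lft 2\<close> and
  \<open>Lft 3\<close>.\<close>

lemma last_layer:
  "\<exists>W E T. apollonian W E T \<and> layer_vertices p \<subseteq> W \<and>
    (\<forall>i<4 * p + 2. \<forall>j<4 * p + 2. last_edge p i j \<longrightarrow> {Lft i, Rgt j} \<in> E) \<and>
    (\<forall>i<4 * p + 2. 4 * p \<le> i \<or> i = 2 \<or> i = 3 \<longrightarrow> {Apex, Lft i} \<in> E) \<and>
    (\<forall>j<4 * p + 2. 4 * p \<le> j \<longrightarrow> {Apex, Rgt j} \<in> E)"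
proof -
  let ?a = "Lft (4 * p)" and ?a' = "Lft (4 * p + 1)" and ?b' = "Rgt (4 * p)" and ?b = "Rgt (4 * p + 1)"
  have "distinct [?a, ?a', ?b']" by simp
  from apollonian.triangle[OF this]
  have 0: "apollonian {?a, ?a', ?b'} {{?a, ?a'}, {?a, ?b'}, {?a', ?b'}} {{?a, ?a', ?b'}}" .
  obtain E1 T1 where 1: "apollonian (insert Apex {?a, ?a', ?b'}) E1 T1"
    "{{?a, ?a'}, {?a, ?b'}, {?a', ?b'}} \<subseteq> E1" "{Apex, ?a} \<in> E1" "{Apex, ?a'} \<in> E1" "{Apex, ?b'} \<in> E1"
    "{{?a, ?a', ?b'}} - {{?a, ?a', ?b'}} \<subseteq> T1"
    "{Apex, ?a, ?a'} \<in> T1" "{Apex, ?a, ?b'} \<in> T1" "{Apex, ?a', ?b'} \<in> T1"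
    by (rule apollonian_stackE[OF 0, of ?a ?a' ?b' Apex]) simp_all
  obtain E2 T2 where 2: "apollonian (insert ?b (insert Apex {?a, ?a', ?b'})) E2 T2"
    "E1 \<subseteq> E2" "{?b, Apex} \<in> E2" "{?b, ?a} \<in> E2" "{?b, ?a'} \<in> E2"
    "T1 - {{Apex, ?a, ?a'}} \<subseteq> T2"
    "{?b, Apex, ?a} \<in> T2" "{?b, Apex, ?a'} \<in> T2" "{?b, ?a, ?a'} \<in> T2"
    by (rule apollonian_stackE[OF 1(1,7), of ?b]) simp_all
  let ?V = "insert ?b (insert Apex {?a, ?a', ?b'})"
  have "?b' \<notin> {Apex, ?a, ?a'}" by simp
  then have "{Apex, ?a', ?b'} \<noteq> {Apex, ?a, ?a'}" by blast
  with 1(9) have F': "{Apex, ?a', ?b'} \<in> T2" by (rule remaining_face[OF 2(6)])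
  have "{?a, ?b, Apex} = {?b, Apex, ?a}" "{?a', ?b', Apex} = {Apex, ?a', ?b'}" by blast+
  with F' 2(7) have F: "{?a, ?b, Apex} \<in> T2" "{?a', ?b', Apex} \<in> T2" by simp_all
  let ?N1 = "\<Union>s<p. {Lft (4 * s), Lft (4 * s + 2), Rgt (4 * s), Rgt (4 * s + 2)}"
  let ?N2 = "\<Union>s<p. {Lft (4 * s + 1), Lft (4 * s + 3), Rgt (4 * s + 1), Rgt (4 * s + 3)}"
  have "\<exists>E' T' q. apollonian (?N1 \<union> ?V) E' T' \<and>
    E2 \<subseteq> E' \<and> T2 - {{?a, ?b, Apex}} \<subseteq> T' \<and> {?a, ?b, q} \<in> T' \<and>
    (p = 0 \<longrightarrow> q = Apex) \<and> {?a, ?b, q} \<notin> T2 - {{?a, ?b, Apex}} \<and>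
    (\<forall>s<p. {{Rgt (4 * s), ?a}, {Rgt (4 * s + 2), ?a}, {Lft (4 * s), ?b}, {Lft (4 * s + 2), ?b},
      {Lft (4 * s), Rgt (4 * s)}, {Lft (4 * s + 2), Rgt (4 * s)}, {Lft (4 * s + 2), Rgt (4 * s + 2)}} \<subseteq> E') \<and>
    (0 < p \<longrightarrow> {Lft (4 * 0 + 2), Apex} \<in> E')"
    by (rule apollonian_chain[OF 2(1) F(1)]) (auto; presburger)+
  then obtain E3 T3 where 3: "apollonian (?N1 \<union> ?V) E3 T3" "E2 \<subseteq> E3" "T2 - {{?a, ?b, Apex}} \<subseteq> T3"
    "\<forall>s<p. {{Rgt (4 * s), ?a}, {Rgt (4 * s + 2), ?a}, {Lft (4 * s), ?b}, {Lft (4 * s + 2), ?b},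
      {Lft (4 * s), Rgt (4 * s)}, {Lft (4 * s + 2), Rgt (4 * s)}, {Lft (4 * s + 2), Rgt (4 * s + 2)}} \<subseteq> E3"
    and first2: "0 < p \<longrightarrow> {Lft (4 * 0 + 2), Apex} \<in> E3"
    by (elim exE conjE) (rule that)
  have "?a' \<notin> {?a, ?b, Apex}" by simp
  then have "{?a', ?b', Apex} \<noteq> {?a, ?b, Apex}" by blast
  with F(2) have F3: "{?a', ?b', Apex} \<in> T3" by (rule remaining_face[OF 3(3)])
  have "\<exists>E' T' q. apollonian (?N2 \<union> (?N1 \<union> ?V)) E' T' \<and>
    E3 \<subseteq> E' \<and> T3 - {{?a', ?b', Apex}} \<subseteq> T' \<and> {?a', ?b', q} \<in> T' \<and>
    (p = 0 \<longrightarrow> q = Apex) \<and> {?a', ?b', q} \<notin> T3 - {{?a', ?b', Apex}} \<and>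
    (\<forall>s<p. {{Rgt (4 * s + 1), ?a'}, {Rgt (4 * s + 3), ?a'}, {Lft (4 * s + 1), ?b'}, {Lft (4 * s + 3), ?b'},
      {Lft (4 * s + 1), Rgt (4 * s + 1)}, {Lft (4 * s + 3), Rgt (4 * s + 1)}, {Lft (4 * s + 3), Rgt (4 * s + 3)}} \<subseteq> E') \<and>
    (0 < p \<longrightarrow> {Lft (4 * 0 + 3), Apex} \<in> E')"
    by (rule apollonian_chain[OF 3(1) F3]) (auto; presburger)+
  then obtain E T where 4: "apollonian (?N2 \<union> (?N1 \<union> ?V)) E T" "E3 \<subseteq> E"
    "\<forall>s<p. {{Rgt (4 * s + 1), ?a'}, {Rgt (4 * s + 3), ?a'}, {Lft (4 * s + 1), ?b'}, {Lft (4 * s + 3), ?b'},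
      {Lft (4 * s + 1), Rgt (4 * s + 1)}, {Lft (4 * s + 3), Rgt (4 * s + 1)}, {Lft (4 * s + 3), Rgt (4 * s + 3)}} \<subseteq> E"
    and first3: "0 < p \<longrightarrow> {Lft (4 * 0 + 3), Apex} \<in> E"
    by (elim exE conjE) (rule that)
  have E2: "E2 \<subseteq> E" using 3(2) 4(2) by (rule subset_trans)
  have E1: "E1 \<subseteq> E" using 2(2) E2 by (rule subset_trans)
  have core: "{?a, ?b'} \<in> E" "{?a', ?b'} \<in> E" "{?a, ?b} \<in> E" "{?a', ?b} \<in> E"
    "{Apex, ?a} \<in> E" "{Apex, ?a'} \<in> E" "{Apex, ?b} \<in> E" "{Apex, ?b'} \<in> E"
    using 1(2-5) 2(3-5) E1 E2 by (auto simp: insert_commute)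
  have even_edges: "{?a, Rgt (4 * s)} \<in> E" "{?a, Rgt (4 * s + 2)} \<in> E" "{Lft (4 * s), ?b} \<in> E"
    "{Lft (4 * s + 2), ?b} \<in> E" "{Lft (4 * s), Rgt (4 * s)} \<in> E" "{Lft (4 * s + 2), Rgt (4 * s)} \<in> E"
    "{Lft (4 * s + 2), Rgt (4 * s + 2)} \<in> E" if "s < p" for s
    using subset_trans[OF 3(4)[rule_format, OF that] 4(2)] by (simp_all add: insert_commute)
  have odd_edges: "{?a', Rgt (4 * s + 1)} \<in> E" "{?a', Rgt (4 * s + 3)} \<in> E" "{Lft (4 * s + 1), ?b'} \<in> E"
    "{Lft (4 * s + 3), ?b'} \<in> E" "{Lft (4 * s + 1), Rgt (4 * s + 1)} \<in> E"
    "{Lft (4 * s + 3), Rgt (4 * s + 1)} \<in> E" "{Lft (4 * s + 3), Rgt (4 * s + 3)} \<in> E" if "s < p" for s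
    using 4(3)[rule_format, OF that] by (simp_all add: insert_commute)
  have i_cases: "i = 4 * p \<or> i = 4 * p + 1 \<or>
      (\<exists>s<p. i = 4 * s \<or> i = 4 * s + 1 \<or> i = 4 * s + 2 \<or> i = 4 * s + 3)" if "i < 4 * p + 2" for i
    using that by presburger
  have lay: "layer_vertices p \<subseteq> ?N2 \<union> (?N1 \<union> ?V)"
  proof -
    have "Lft i \<in> ?N2 \<union> (?N1 \<union> ?V) \<and> Rgt i \<in> ?N2 \<union> (?N1 \<union> ?V)" if i: "i < 4 * p + 2" for i
    proof -
      consider "i = 4 * p" | "i = 4 * p + 1"
        | s where "s < p" "i = 4 * s \<or> i = 4 * s + 1 \<or> i = 4 * s + 2 \<or> i = 4 * s + 3"
        using i_cases[OF i] by blast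
      then show ?thesis
      proof cases
        case 3
        have "{Lft (4 * s), Lft (4 * s + 2), Rgt (4 * s), Rgt (4 * s + 2)} \<subseteq> ?N1"
          by (rule UN_upper[where B = "\<lambda>s. {Lft (4 * s), Lft (4 * s + 2), Rgt (4 * s), Rgt (4 * s + 2)}"])
            (use 3(1) in simp)
        moreover have "{Lft (4 * s + 1), Lft (4 * s + 3), Rgt (4 * s + 1), Rgt (4 * s + 3)} \<subseteq> ?N2"
          by (rule UN_upper[where B = "\<lambda>s. {Lft (4 * s + 1), Lft (4 * s + 3), Rgt (4 * s + 1), Rgt (4 * s + 3)}"])
            (use 3(1) in simp)
        ultimately show ?thesis using 3(2) by blast
      qed simp_all
    qed
    then show ?thesis unfolding layer_vertices_def by blast
  qed
  have edge: "{Lft i, Rgt j} \<in> E" if ij: "i < 4 * p + 2" "j < 4 * p + 2" and e: "last_edge p i j" for i j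
  proof -
    consider "4 * p \<le> i" "4 * p \<le> j" | "4 * p \<le> i" "j < 4 * p" "even i \<longleftrightarrow> even j"
      | "i < 4 * p" "4 * p \<le> j" "even i \<longleftrightarrow> odd j"
      | "i < 4 * p" "j < 4 * p" "i div 4 = j div 4" "even i \<longleftrightarrow> even j" "j \<noteq> i + 2"
      using e unfolding last_edge_def by linarith
    then show ?thesis
    proof cases
      case 1
      then have "i = 4 * p \<or> i = 4 * p + 1" "j = 4 * p \<or> j = 4 * p + 1" using ij by linarith+
      then show ?thesis using core by auto
    next
      case 2
      have i: "i = 4 * p \<or> i = 4 * p + 1" using 2 ij by linarith
      define s where "s = j div 4"
      have s: "s < p" using 2 unfolding s_def by linarith
      show ?thesis
        by (rule group_cases[OF s_def[symmetric]])
          (use i even_edges(1,2)[OF s] odd_edges(1,2)[OF s] 2(3) in auto)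
    next
      case 3
      have j: "j = 4 * p \<or> j = 4 * p + 1" using 3 ij by linarith
      define s where "s = i div 4"
      have s: "s < p" using 3 unfolding s_def by linarith
      show ?thesis
        by (rule group_cases[OF s_def[symmetric]])
          (use j even_edges(3,4)[OF s] odd_edges(3,4)[OF s] 3(3) in auto)
    next
      case 4
      define s where "s = i div 4"
      have s: "s < p" using 4 by (simp add: s_def less_mult_imp_div_less mult.commute)
      have i: "i div 4 = s" and j: "j div 4 = s" using 4(3) by (simp_all add: s_def)
      show ?thesis
        by (rule group_cases[OF i]; rule group_cases[OF j])
          (use 4(4,5) even_edges[OF s] odd_edges[OF s] in simp_all)
    qed
  qed
  have apexL: "{Apex, Lft i} \<in> E" if i: "i < 4 * p + 2" "4 * p \<le> i \<or> i = 2 \<or> i = 3" for i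
  proof -
    consider "i = 4 * p" | "i = 4 * p + 1" | "0 < p" "i = 2" | "0 < p" "i = 3"
      using i by linarith
    then show ?thesis
    proof cases
      case 3
      have "{Lft 2, Apex} \<in> E" using subsetD[OF 4(2)] first2 3(1) by (simp add: numeral_2_eq_2)
      then show ?thesis unfolding 3(2) by (simp add: insert_commute)
    next
      case 4
      have "{Lft 3, Apex} \<in> E" using first3 4(1) by simp
      then show ?thesis unfolding 4(2) by (simp add: insert_commute)
    qed (use core in simp_all)
  qed
  have apexR: "{Apex, Rgt j} \<in> E" if "j < 4 * p + 2" "4 * p \<le> j" for j
  proof -
    have "j = 4 * p \<or> j = 4 * p + 1" using that by linarith
    then show ?thesis using core by auto
  qed
  show ?thesis
    by (intro exI[of _ "?N2 \<union> (?N1 \<union> ?V)"] exI[of _ E] exI[of _ T] conjI allI impI;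
      (rule 4(1) | rule lay | rule edge; assumption | rule apexL; assumption | rule apexR; assumption))
qed

section \<open>The thickness\<close>

text \<open>Of the two arcs of an edge only the one leaving \<open>X\<close> is taken. Starts then
  lie in the image of \<open>X\<close> and finishes in that of \<open>Y\<close>, as the bound for
  bipartite arc systems requires.\<close>

lemma planar_bipartite_bound:
  assumes "planar H" "finite X" "finite Y" "X \<inter> Y = {}"
    and four: "4 \<le> card (parcs H \<inter> X \<times> Y)"
  shows "card (parcs H \<inter> X \<times> Y) + 4 \<le> 2 * (card X + card Y)"
proof -
  let ?B = "parcs H \<inter> X \<times> Y"
  obtain p c where H: "pair_graph H" and draw: "plane_drawing H p c"
    using assms(1) unfolding planar_def by blast
  interpret pair_graph H by fact
  have inj: "inj_on p (pverts H)"
    using draw unfolding plane_drawing_def by blast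
  have arc: "Path_Connected.arc (c (u, v))" and start: "pathstart (c (u, v)) = p u"
    and finish: "pathfinish (c (u, v)) = p v"
    and inner: "(path_image (c (u, v)) - {p u, p v}) \<inter> p ` pverts H = {}"
    if "(u, v) \<in> parcs H" for u v
    using draw that unfolding plane_drawing_def by fast+
  have apart: "(path_image (c (u, v)) - {p u, p v}) \<inter> path_image (c (x, y)) = {}"
    if "(u, v) \<in> parcs H" "(x, y) \<in> parcs H" "{x, y} \<noteq> {u, v}" for u v x y
    using draw that unfolding plane_drawing_def by fast
  have B: "u \<in> X" "v \<in> Y" "(u, v) \<in> parcs H" "u \<in> pverts H" "v \<in> pverts H" if "(u, v) \<in> ?B" for u v
    using that in_arcsD1 in_arcsD2 by auto
  let ?P = "p ` ((X \<union> Y) \<inter> pverts H)" and ?A = "c ` ?B"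
  have p_eq: "u = x" if "u \<in> pverts H" "x \<in> pverts H" "p u = p x" for u x
    using inj_onD[OF inj that(3,1,2)] .
  have inj_c: "inj_on c ?B"
  proof (rule inj_onI, clarify)
    fix u v x y assume uv: "(u, v) \<in> parcs H" "u \<in> X" "v \<in> Y" and xy: "(x, y) \<in> parcs H" "x \<in> X" "y \<in> Y"
      and eq: "c (u, v) = c (x, y)"
    have "p u = p x" "p v = p y"
      using start[OF uv(1)] start[OF xy(1)] finish[OF uv(1)] finish[OF xy(1)] eq by simp_all
    then show "u = x \<and> v = y"
      using p_eq in_arcsD1[OF uv(1)] in_arcsD1[OF xy(1)] in_arcsD2[OF uv(1)] in_arcsD2[OF xy(1)] by blast
  qed
  have sys: "arc_system ?P ?A"
  proof
    show "finite ?P" using assms(2,3) by simp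
    show "finite ?A" using assms(2,3) by simp
  next
    fix g assume "g \<in> ?A"
    then obtain u v where uv: "(u, v) \<in> ?B" and g: "g = c (u, v)" by auto
    note b = B[OF uv]
    show "Path_Connected.arc g" unfolding g by (rule arc[OF b(3)])
    show "pathstart g \<in> ?P" unfolding g start[OF b(3)] using b by blast
    show "pathfinish g \<in> ?P" unfolding g finish[OF b(3)] using b by blast
    show "arc_inner g \<inter> ?P = {}"
      unfolding g start[OF b(3)] finish[OF b(3)] using inner[OF b(3)] by blast
    fix h assume "h \<in> ?A" and ne: "g \<noteq> h"
    then obtain x y where xy: "(x, y) \<in> ?B" and h: "h = c (x, y)" by auto
    note b' = B[OF xy]
    have "{x, y} \<noteq> {u, v}"
      using ne b(1,2) b'(1,2) assms(4) unfolding g h by (auto simp: doubleton_eq_iff)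
    then show "arc_inner g \<inter> path_image h = {}"
      unfolding g h start[OF b(3)] finish[OF b(3)] by (rule apart[OF b(3) b'(3)])
  qed
  have card_A: "card ?A = card ?B" by (rule card_image[OF inj_c])
  have "inj_on (\<lambda>g. (pathstart g, pathfinish g)) ?A"
  proof (rule inj_onI)
    fix g h assume "g \<in> ?A" "h \<in> ?A" and eq: "(pathstart g, pathfinish g) = (pathstart h, pathfinish h)"
    then obtain u v x y where uv: "(u, v) \<in> ?B" "g = c (u, v)" and xy: "(x, y) \<in> ?B" "h = c (x, y)"
      by auto
    note b = B[OF uv(1)] and b' = B[OF xy(1)]
    have "p u = p x" "p v = p y"
      using eq start[OF b(3)] start[OF b'(3)] finish[OF b(3)] finish[OF b'(3)] uv(2) xy(2) by simp_all
    then have "u = x" "v = y" using p_eq b(4,5) b'(4,5) by blast+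
    then show "g = h" using uv(2) xy(2) by simp
  qed
  moreover have "pathstart ` ?A \<inter> pathfinish ` ?A = {}"
  proof (rule ccontr)
    assume "\<not> ?thesis"
    then obtain g h where "g \<in> ?A" "h \<in> ?A" and eq: "pathstart g = pathfinish h" by auto
    then obtain u v x y where uv: "(u, v) \<in> ?B" "g = c (u, v)" and xy: "(x, y) \<in> ?B" "h = c (x, y)"
      by auto
    note b = B[OF uv(1)] and b' = B[OF xy(1)]
    have "p u = p y"
      using eq start[OF b(3)] finish[OF b'(3)] uv(2) xy(2) by simp
    then have "u = y" using p_eq b(4) b'(5) by blast
    then show False using b(1) b'(2) assms(4) by blast
  qed
  ultimately have bound: "card ?A + 4 \<le> 2 * card ?P"
    using arc_system.bipartite_arcs_bound[OF sys] four card_A by simp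
  have "card ?P \<le> card ((X \<union> Y) \<inter> pverts H)"
    by (rule card_image_le) (use assms(2,3) in simp)
  also have "\<dots> \<le> card (X \<union> Y)"
    by (rule card_mono) (use assms(2,3) in auto)
  also have "\<dots> \<le> card X + card Y" by (rule card_Un_le)
  finally have "2 * card ?P \<le> 2 * (card X + card Y)" by (rule mult_le_mono2)
  with bound have "card ?A + 4 \<le> 2 * (card X + card Y)" by (rule order_trans)
  then show ?thesis unfolding card_A .
qed

lemma planar_cover_bound:
  assumes n: "2 \<le> n" and XY: "finite X" "finite Y" "X \<inter> Y = {}" "card X = n" "card Y = n"
    and Hs: "finite Hs" "\<forall>H\<in>Hs. planar H" "X \<times> Y \<subseteq> (\<Union>H\<in>Hs. parcs H)"
  shows "(n + 1) div 4 + 1 \<le> card Hs"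
proof -
  have le: "card (parcs H \<inter> X \<times> Y) \<le> 4 * (n - 1)" if "H \<in> Hs" for H
  proof (cases "4 \<le> card (parcs H \<inter> X \<times> Y)")
    case True
    have "planar H" using Hs(2) that by blast
    then show ?thesis
      using planar_bipartite_bound[OF _ XY(1-3) True] XY(4,5) by simp
  \<comment> \<open>A graph with fewer than four of these edges obeys the bound because
    \<open>4 \<le> 4 * (n - 1)\<close>.\<close>
  qed (use n in simp)
  have "n * n = card (X \<times> Y)" using XY by simp
  also have "X \<times> Y = (\<Union>H\<in>Hs. parcs H \<inter> X \<times> Y)" using Hs(3) by blast
  also have "card \<dots> \<le> (\<Sum>H\<in>Hs. card (parcs H \<inter> X \<times> Y))"
    by (rule card_UN_le[OF Hs(1)])
  also have "\<dots> \<le> (\<Sum>H\<in>Hs. 4 * (n - 1))"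
    by (rule sum_mono) (rule le)
  finally have "n * n \<le> card Hs * (4 * (n - 1))" by simp
  moreover have "n = (n - 1) + 1" "1 \<le> n - 1" using n by simp_all
  then obtain m where m: "n = m + 1" "1 \<le> m" by blast
  \<comment> \<open>\<open>n * n\<close> is \<open>(m + 2) * m + 1\<close>. The summand 1 makes the
    inequality strict, which decides the value when 4 divides \<open>n + 1\<close>.\<close>
  ultimately have "(m + 2) * m < (4 * card Hs) * m"
    using m by (simp add: algebra_simps)
  then have "m + 2 < 4 * card Hs" using mult_less_cancel2[of "m + 2" m "4 * card Hs"] by blast
  then show ?thesis using m(1) by linarith
qed

lemma ceiling_quarter: "\<lceil>(real n + 2) / 4\<rceil> = int ((n + 1) div 4 + 1)"
proof (rule ceiling_unique)
  define d r where "d = (n + 1) div 4" and "r = (n + 1) mod 4"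
  have "n + 1 = 4 * d + r" "r < 4" by (simp_all add: d_def r_def)
  then have "real n + 1 = 4 * real d + real r" "real r \<le> 3" by linarith+
  then show "of_int (int (d + 1)) - 1 < (real n + 2) / 4" "(real n + 2) / 4 \<le> of_int (int (d + 1))"
    by simp_all
qed

section \<open>Assembly of the layers into a decomposition\<close>

lemma layers:
  obtains E where "\<And>k. k \<le> p \<Longrightarrow> \<exists>W T. apollonian W (E k) T \<and> layer_vertices p \<subseteq> W"
    "\<And>i j. i < 4 * p + 2 \<Longrightarrow> j < 4 * p + 2 \<Longrightarrow> \<exists>k\<le>p. {Lft i, Rgt j} \<in> E k"
    "\<And>i. i < 4 * p + 2 \<Longrightarrow> \<exists>k\<le>p. {Apex, Lft i} \<in> E k"
    "\<And>j. j < 4 * p + 2 \<Longrightarrow> \<exists>k\<le>p. {Apex, Rgt j} \<in> E k"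
proof -
  define Q where "Q s E \<longleftrightarrow> (\<exists>W T. apollonian W E T \<and> layer_vertices p \<subseteq> W) \<and>
    (\<forall>i<4 * p + 2. \<forall>j<4 * p + 2. inner_edge s i j \<longrightarrow> {Lft i, Rgt j} \<in> E) \<and>
    (\<forall>i<4 * p + 2. i \<in> {4 * s, 4 * s + 1, 4 * s + 6, 4 * s + 7} \<longrightarrow> {Apex, Lft i} \<in> E) \<and>
    (\<forall>j. j div 4 = s \<longrightarrow> {Apex, Rgt j} \<in> E)" for s E
  have "\<exists>E. Q s E" if "s < p" for s
    using inner_layer[OF that] unfolding Q_def by blast
  then obtain F where F: "\<And>s. s < p \<Longrightarrow> Q s (F s)" by metis
  obtain L where L: "\<exists>W T. apollonian W L T \<and> layer_vertices p \<subseteq> W"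
    and last: "\<And>i j. i < 4 * p + 2 \<Longrightarrow> j < 4 * p + 2 \<Longrightarrow> last_edge p i j \<Longrightarrow> {Lft i, Rgt j} \<in> L"
    and lastL: "\<And>i. i < 4 * p + 2 \<Longrightarrow> 4 * p \<le> i \<or> i = 2 \<or> i = 3 \<Longrightarrow> {Apex, Lft i} \<in> L"
    and lastR: "\<And>j. j < 4 * p + 2 \<Longrightarrow> 4 * p \<le> j \<Longrightarrow> {Apex, Rgt j} \<in> L"
    using last_layer[of p] by blast
  define E where "E k = (if k = p then L else F k)" for k
  have E: "E p = L" "\<And>s. s < p \<Longrightarrow> E s = F s" by (simp_all add: E_def)
  have in_last: "\<exists>k\<le>p. e \<in> E k" if "e \<in> L" for e
    using that E(1) by blast
  have in_inner: "\<exists>k\<le>p. e \<in> E k" if "s < p" "e \<in> F s" for e s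
    using that E(2) by (intro exI[of _ s]) simp
  show thesis
  proof (rule that[of E])
    fix k assume "k \<le> p"
    then show "\<exists>W T. apollonian W (E k) T \<and> layer_vertices p \<subseteq> W"
      using L F[of k] unfolding E_def Q_def by (cases "k = p") simp_all
  next
    fix i j assume ij: "i < 4 * p + 2" "j < 4 * p + 2"
    from layers_cover[OF ij] show "\<exists>k\<le>p. {Lft i, Rgt j} \<in> E k"
    proof
      assume "last_edge p i j"
      then show ?thesis using in_last last[OF ij] by blast
    next
      assume "\<exists>s<p. inner_edge s i j"
      then obtain s where s: "s < p" "inner_edge s i j" by blast
      have "{Lft i, Rgt j} \<in> F s" using F[OF s(1)] s(2) ij unfolding Q_def by blast
      then show ?thesis by (rule in_inner[OF s(1)])
    qed
  next
    fix i assume i: "i < 4 * p + 2"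
    show "\<exists>k\<le>p. {Apex, Lft i} \<in> E k"
    proof (cases "4 * p \<le> i \<or> i = 2 \<or> i = 3")
      case True
      then show ?thesis using in_last lastL[OF i] by blast
    next
      case False
      define r where "r = i div 4"
      have "r < p" using False unfolding r_def by linarith
      \<comment> \<open>The apex sees positions 0 and 1 of a group in the layer of that group,
        positions 2 and 3 in the layer of the preceding group. The first group has no predecessor,
        so 2 and 3 were left to the last layer.\<close>
      have "\<exists>s<p. i \<in> {4 * s, 4 * s + 1, 4 * s + 6, 4 * s + 7}"
      proof (rule group_cases[OF r_def[symmetric]])
        assume "i = 4 * r"
        then show ?thesis using \<open>r < p\<close> by blast
      next
        assume "i = 4 * r + 1"
        then show ?thesis using \<open>r < p\<close> by blast
      next
        assume "i = 4 * r + 2"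
        moreover from this have "r \<noteq> 0" using False by auto
        ultimately have "r - 1 < p" "i = 4 * (r - 1) + 6" using \<open>r < p\<close> by simp_all
        then show ?thesis by blast
      next
        assume "i = 4 * r + 3"
        moreover from this have "r \<noteq> 0" using False by auto
        ultimately have "r - 1 < p" "i = 4 * (r - 1) + 7" using \<open>r < p\<close> by simp_all
        then show ?thesis by blast
      qed
      then obtain s where s: "s < p" "i \<in> {4 * s, 4 * s + 1, 4 * s + 6, 4 * s + 7}" by blast
      have "{Apex, Lft i} \<in> F s" using F[OF s(1)] s(2) i unfolding Q_def by blast
      then show ?thesis by (rule in_inner[OF s(1)])
    qed
  next
    fix j assume j: "j < 4 * p + 2"
    show "\<exists>k\<le>p. {Apex, Rgt j} \<in> E k"
    proof (cases "4 * p \<le> j")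
      case True
      then show ?thesis using in_last lastR[OF j] by blast
    next
      case False
      then have s: "j div 4 < p" by linarith
      have "{Apex, Rgt j} \<in> F (j div 4)" using F[OF s] unfolding Q_def by blast
      then show ?thesis by (rule in_inner[OF s])
    qed
  qed
qed

lemma complete_tripartiteE:
  assumes "complete_multipartite [1, n, n] G"
  obtains x X Y where "pair_graph G" "pverts G = insert x (X \<union> Y)" "finite X" "finite Y"
    "X \<inter> Y = {}" "x \<notin> X" "x \<notin> Y" "card X = n" "card Y = n"
    "parcs G = {x} \<times> (X \<union> Y) \<union> (X \<union> Y) \<times> {x} \<union> X \<times> Y \<union> Y \<times> X"
proof -
  obtain P :: "nat \<Rightarrow> 'a set" where G: "pair_graph G"
    and dis: "disjoint_family_on P {..<3}" and V: "pverts G = (\<Union>i<3. P i)"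
    and card: "\<forall>i<3. card (P i) = [1, n, n] ! i"
    and A: "parcs G = {(u, v). \<exists>i<3. \<exists>j<3. i \<noteq> j \<and> u \<in> P i \<and> v \<in> P j}"
    using assms unfolding complete_multipartite_def by (auto simp: numeral_3_eq_3)
  have three: "(\<exists>i<3. R i) \<longleftrightarrow> R 0 \<or> R 1 \<or> R 2" for R :: "nat \<Rightarrow> bool"
    by (auto simp: numeral_3_eq_3 numeral_2_eq_2 less_Suc_eq)
  have "card (P 0) = 1" "card (P 1) = n" "card (P 2) = n"
    using card by (simp_all add: numeral_2_eq_2)
  moreover from this obtain x where x: "P 0 = {x}" by (metis card_1_singletonE)
  moreover have V': "pverts G = insert x (P 1 \<union> P 2)"
    unfolding V using x three by (auto simp: set_eq_iff Bex_def)
  moreover have "finite (pverts G)" by (rule pair_fin_digraph.pair_finite_verts) (use G in \<open>simp add: pair_graph_def pair_digraph_def\<close>)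
  then have "finite (P 1)" "finite (P 2)" unfolding V' by simp_all
  moreover have "P i \<inter> P j = {}" if "i < 3" "j < 3" "i \<noteq> j" for i j
    using dis that unfolding disjoint_family_on_def by simp
  from this[of 0 1] this[of 0 2] this[of 1 2] have "x \<notin> P 1" "x \<notin> P 2" "P 1 \<inter> P 2 = {}"
    using x by simp_all
  moreover have "parcs G = {x} \<times> (P 1 \<union> P 2) \<union> (P 1 \<union> P 2) \<times> {x} \<union> P 1 \<times> P 2 \<union> P 2 \<times> P 1"
    unfolding A three using x by auto
  ultimately show thesis using that[of x "P 1" "P 2"] G by simp
qed

lemma with_proj_Union_eq:
  "pre_digraph.Union (with_proj G) (with_proj ` Hs) = with_proj G \<longleftrightarrow>
    (\<Union>H\<in>Hs. pverts H) = pverts G \<and> (\<Union>H\<in>Hs. parcs H) = parcs G"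
  by (simp add: pre_digraph.Union_def with_proj_def)

lemma planar_decomposition:
  assumes "complete_multipartite [1, n, n] G" "n \<le> 4 * p + 2"
  shows "\<exists>Hs. finite Hs \<and> card Hs \<le> p + 1 \<and>
    (\<forall>H\<in>Hs. subgraph (with_proj H) (with_proj G) \<and> planar H) \<and>
    pre_digraph.Union (with_proj G) (with_proj ` Hs) = with_proj G"
proof -
  obtain x X Y where G: "pair_graph G" "pverts G = insert x (X \<union> Y)" "finite X" "finite Y"
    "X \<inter> Y = {}" "x \<notin> X" "x \<notin> Y" "card X = n" "card Y = n"
    "parcs G = {x} \<times> (X \<union> Y) \<union> (X \<union> Y) \<times> {x} \<union> X \<times> Y \<union> Y \<times> X"
    by (rule complete_tripartiteE[OF assms(1)])
  interpret pair_graph G by (rule G(1))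
  obtain f where f: "bij_betw f X {0..<n}"
    using ex_bij_betw_finite_nat[OF G(3)] G(8) by blast
  obtain g where g: "bij_betw g Y {0..<n}"
    using ex_bij_betw_finite_nat[OF G(4)] G(9) by blast
  have fn: "f u < 4 * p + 2" if "u \<in> X" for u
    using bij_betwE[OF f] that assms(2) by fastforce
  have gn: "g v < 4 * p + 2" if "v \<in> Y" for v
    using bij_betwE[OF g] that assms(2) by fastforce
  define \<phi> where "\<phi> v = (if v = x then Apex else if v \<in> X then Lft (f v) else Rgt (g v))" for v
  have \<phi>: "\<phi> x = Apex" "\<And>v. v \<in> X \<Longrightarrow> \<phi> v = Lft (f v)" "\<And>v. v \<in> Y \<Longrightarrow> \<phi> v = Rgt (g v)"
    using G(5-7) by (auto simp: \<phi>_def)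
  have inj: "inj_on \<phi> (pverts G)"
  proof (rule inj_onI)
    fix u v assume "u \<in> pverts G" "v \<in> pverts G" "\<phi> u = \<phi> v"
    then show "u = v"
      unfolding G(2) using \<phi> bij_betw_imp_inj_on[OF f] bij_betw_imp_inj_on[OF g]
      by (auto dest: inj_onD)
  qed
  have im: "\<phi> ` pverts G \<subseteq> layer_vertices p"
    unfolding G(2) layer_vertices_def using \<phi> fn gn by auto
  obtain E where E: "\<And>k. k \<le> p \<Longrightarrow> \<exists>W T. apollonian W (E k) T \<and> layer_vertices p \<subseteq> W"
    "\<And>i j. i < 4 * p + 2 \<Longrightarrow> j < 4 * p + 2 \<Longrightarrow> \<exists>k\<le>p. {Lft i, Rgt j} \<in> E k"
    "\<And>i. i < 4 * p + 2 \<Longrightarrow> \<exists>k\<le>p. {Apex, Lft i} \<in> E k"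
    "\<And>j. j < 4 * p + 2 \<Longrightarrow> \<exists>k\<le>p. {Apex, Rgt j} \<in> E k"
    using layers[of p] by blast
  \<comment> \<open>Each layer keeps all vertices, so the union has the right vertex set even if a
    layer has no edges.\<close>
  define H where "H k = \<lparr>pverts = pverts G, parcs = {(u, v) \<in> parcs G. {\<phi> u, \<phi> v} \<in> E k}\<rparr>" for k
  have pgH: "pair_graph (H k)" for k
  proof
    show "finite (pverts (H k))" by (simp add: H_def pair_finite_verts)
    show "finite (parcs (H k))"
      by (rule finite_subset[OF _ pair_finite_arcs]) (auto simp: H_def)
    show "symmetric (with_proj (H k))"
    proof -
      have "(v, u) \<in> parcs G" if "(u, v) \<in> parcs G" for u v
        using that unfolding G(10) by blast
      then have "sym (parcs (H k))"
        unfolding sym_def H_def by (auto simp: insert_commute)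
      then show ?thesis by (simp add: symmetric_def)
    qed
    fix e assume "e \<in> parcs (H k)"
    then have e: "e \<in> parcs G" by (auto simp: H_def)
    show "fst e \<in> pverts (H k)" "snd e \<in> pverts (H k)" "fst e \<noteq> snd e"
      using arc_fst_in_verts[OF e] arc_snd_in_verts[OF e] pair_no_loops[OF e] by (simp_all add: H_def)
  qed
  have sub: "subgraph (with_proj (H k)) (with_proj G)" for k
  proof -
    have "wf_digraph (with_proj (H k))"
      using pgH[of k] by (simp add: wf_digraph_wp_iff pair_graph_def pair_digraph_def pair_fin_digraph_def)
    moreover have "wf_digraph (with_proj G)"
      using G(1) by (simp add: wf_digraph_wp_iff pair_graph_def pair_digraph_def pair_fin_digraph_def)
    ultimately show ?thesis
      by (auto simp: subgraph_def compatible_def H_def)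
  qed
  have plan: "planar (H k)" if k: "k \<le> p" for k
  proof -
    obtain W T where W: "apollonian W (E k) T" "layer_vertices p \<subseteq> W"
      using E(1)[OF k] by blast
    show ?thesis
    proof (rule planar_subgraph_apollonian[OF W(1) pgH])
      show "inj_on \<phi> (pverts (H k))" using inj by (simp add: H_def)
      show "\<phi> ` pverts (H k) \<subseteq> W" using im W(2) by (simp add: H_def)
    qed (simp add: H_def)
  qed
  have cover: "\<exists>k\<le>p. {\<phi> u, \<phi> v} \<in> E k" if "(u, v) \<in> parcs G" for u v
  proof -
    have XY: "\<exists>k\<le>p. {\<phi> u, \<phi> v} \<in> E k" if "u \<in> X" "v \<in> Y" for u v
      using E(2)[OF fn[OF that(1)] gn[OF that(2)]] by (simp add: \<phi>(2)[OF that(1)] \<phi>(3)[OF that(2)])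
    have xX: "\<exists>k\<le>p. {\<phi> x, \<phi> v} \<in> E k" if "v \<in> X" for v
      using E(3)[OF fn[OF that]] by (simp add: \<phi>(1) \<phi>(2)[OF that])
    have xY: "\<exists>k\<le>p. {\<phi> x, \<phi> v} \<in> E k" if "v \<in> Y" for v
      using E(4)[OF gn[OF that]] by (simp add: \<phi>(1) \<phi>(3)[OF that])
    consider "u = x" "v \<in> X" | "u = x" "v \<in> Y" | "v = x" "u \<in> X" | "v = x" "u \<in> Y"
      | "u \<in> X" "v \<in> Y" | "u \<in> Y" "v \<in> X"
      using \<open>(u, v) \<in> parcs G\<close> unfolding G(10) by blast
    then show ?thesis
    proof cases
      case 1
      show ?thesis unfolding 1(1) by (rule xX[OF 1(2)])
    next
      case 2
      show ?thesis unfolding 2(1) by (rule xY[OF 2(2)])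
    next
      case 3
      show ?thesis unfolding 3(1) by (subst insert_commute) (rule xX[OF 3(2)])
    next
      case 4
      show ?thesis unfolding 4(1) by (subst insert_commute) (rule xY[OF 4(2)])
    next
      case 5
      show ?thesis by (rule XY[OF 5])
    next
      case 6
      show ?thesis by (subst insert_commute) (rule XY[OF 6(2,1)])
    qed
  qed
  let ?Hs = "H ` {..p}"
  have "(\<Union>K\<in>?Hs. pverts K) = pverts G" by (simp add: H_def)
  moreover have "(\<Union>K\<in>?Hs. parcs K) = parcs G"
  proof
    show "(\<Union>K\<in>?Hs. parcs K) \<subseteq> parcs G" by (auto simp: H_def)
    show "parcs G \<subseteq> (\<Union>K\<in>?Hs. parcs K)" using cover by (auto simp: H_def)
  qed
  ultimately have "pre_digraph.Union (with_proj G) (with_proj ` ?Hs) = with_proj G"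
    by (simp only: with_proj_Union_eq simp_thms)
  \<comment> \<open>Different \<open>k\<close> may give the same graph, hence only an upper bound;
    equality follows later from the lower bound.\<close>
  moreover have "card ?Hs \<le> p + 1"
    using card_image_le[of "{..p}" H] by simp
  ultimately show ?thesis using sub plan by (intro exI[of _ ?Hs]) auto
qed

theorem theorem2p4:
  fixes n :: nat and G :: "'a pair_pre_digraph"
  assumes "n \<ge> 1"
    and "complete_multipartite [1, n, n] G"
  shows "int (thickness G) = \<lceil>(real n + 2) / 4\<rceil>"
proof -
  let ?D = "\<lambda>k. \<exists>Hs. finite Hs \<and> card Hs = k \<and>
    (\<forall>H\<in>Hs. subgraph (with_proj H) (with_proj G) \<and> planar H) \<and>
    pre_digraph.Union (with_proj G) (with_proj ` Hs) = with_proj G"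
  define p where "p = (n + 1) div 4"
  \<comment> \<open>\<open>4 * p + 2\<close> is the largest number with this value of
    \<open>p\<close>, and \<open>p + 1\<close> is the ceiling in question by
    \<open>ceiling_quarter\<close>.\<close>
  have "n \<le> 4 * p + 2" unfolding p_def by linarith
  from planar_decomposition[OF assms(2) this]
  obtain k where k: "k \<le> p + 1" "?D k" by blast
  have lower: "p + 1 \<le> k" if "?D k" for k
  proof -
    from that obtain Hs where fin: "finite Hs" "card Hs = k"
      and pl: "\<forall>H\<in>Hs. subgraph (with_proj H) (with_proj G) \<and> planar H"
      and un: "pre_digraph.Union (with_proj G) (with_proj ` Hs) = with_proj G"
      by (elim exE conjE)
    have "\<forall>H\<in>Hs. planar H" using pl by simp
    moreover have "(\<Union>H\<in>Hs. pverts H) = pverts G" "(\<Union>H\<in>Hs. parcs H) = parcs G"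
      using un unfolding with_proj_Union_eq by simp_all
    ultimately have Hs: "finite Hs" "card Hs = k" "\<forall>H\<in>Hs. planar H"
      "(\<Union>H\<in>Hs. pverts H) = pverts G" "(\<Union>H\<in>Hs. parcs H) = parcs G"
      using fin by simp_all
    obtain x X Y where G: "pair_graph G" "pverts G = insert x (X \<union> Y)" "finite X" "finite Y"
      "X \<inter> Y = {}" "x \<notin> X" "x \<notin> Y" "card X = n" "card Y = n"
      "parcs G = {x} \<times> (X \<union> Y) \<union> (X \<union> Y) \<times> {x} \<union> X \<times> Y \<union> Y \<times> X"
      by (rule complete_tripartiteE[OF assms(2)])
    show ?thesis
    proof (cases "2 \<le> n")
      case True
      have "X \<times> Y \<subseteq> (\<Union>H\<in>Hs. parcs H)" unfolding Hs(5) G(10) by blast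
      from planar_cover_bound[OF True G(3-5,8,9) Hs(1,3) this] show ?thesis
        unfolding p_def Hs(2) .
    next
      case False
      \<comment> \<open>Here \<open>p = 0\<close>, and the nonempty vertex set forces at least one
        graph.\<close>
      have "Hs \<noteq> {}" using Hs(4) G(2) by auto
      then have "0 < k" using Hs(1,2) by (auto simp: card_gt_0_iff)
      then show ?thesis using False unfolding p_def by simp
    qed
  qed
  have "k = p + 1" using k(1) lower[OF k(2)] by (rule le_antisym)
  then have "?D (p + 1)" using k(2) by simp
  then have "thickness G = p + 1"
    unfolding thickness_def using lower by (rule Least_equality)
  then show ?thesis unfolding ceiling_quarter p_def by simp
qed

end
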